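(* Let $n\ge 2$ be an integer, $0\le \alpha<1$, $\mu\ge 0$ and $1<p\le p_F(n(1-\alpha))$, where $p_F(n(1-\alpha))=1+\frac{2}{n(1-\alpha)}$. Assume that $u_0\in C^2(\mathbf{R}^n)$ and $u_1\in C^1(\mathbf{R}^n)$ are nonnegative, nontrivial (neither is identically zero) and $\operatorname{supp}u_0,\ \operatorname{supp}u_1\subset\{|x|\le R\}$ with $R>0$. Let $\varepsilon>0$ and suppose that the Cauchy problem $$ \begin{cases} u_{tt}-\dfrac{1}{t^{2\alpha}}\Delta u+\dfrac{\mu}{t}u_t=|u|^p, & t>1,\ x\in\mathbf{R}^n,\\ u(1,x)=\varepsilon u_0(x),\quad u_t(1,x)=\varepsilon u_1(x), & x\in\mathbf{R}^n, \end{cases} $$ has a classical solution $u\in C^2([1,T)\times\mathbf{R}^n)$. Then $T<\infty$, and there exists a constant $\varepsilon_0>0$ depending on $p,\alpha,\mu,R,u_0,u_1$ such that the lifespan $T_\varepsilon$ has to satisfy, for $0<\varepsilon\le\varepsilon_0$, \begin{align*} T_\varepsilon&\le C\varepsilon^{-\frac{p-1}{2-n(1-\alpha)(p-1)}} && \text{if } p<p_F(n(1-\alpha)),\\ T_\varepsilon&\le \exp\left(C\varepsilon^{-p(p-1)/(p+1)}\right) && \text{if } p=p_F(n(1-\alpha)) \text{ and } 0\le\mu\le 1,\\ T_\varepsilon&\le \exp\left(C\varepsilon^{-(p-1)}\right) && \text{if } p=p_F(n(1-\alpha)) \text{ and } \mu>1, \end{align*} where $C>0$ is a constant independent of $\v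arepsilon$.
   Context: $\Delta=\partial_1^2+\cdots+\partial_n^2$ is the Laplacian in $x=(x^1,\dots,x^n)\in\mathbf{R}^n$, and $u=u(t,x)$ is real-valued. For a real number $d>0$, $p_F(d)=1+2/d$ denotes the Fujita exponent. The parameter $\varepsilon>0$ is small. The lifespan $T_\varepsilon$ is the supremum of all $T$ such that the Cauchy problem (with the given $\varepsilon$) has a (classical, $C^2$) solution for $x\in\mathbf{R}^n$ and $1\le t<T$. *)

theory Defs
  imports "HOL-Analysis.Analysis"
begin

text \<open>
  \<open>Ck_on k S f\<close>: \<open>f\<close> is of class \<open>C\<^sup>k\<close> on \<open>S\<close>. The family \<open>g\<close> consists of the first-order partial
  derivatives. Derivatives are taken within \<open>S\<close>; for \<open>S = [1,T) \<times> \<real>\<^sup>n\<close> this means one-sided time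
  derivatives at \<open>t = 1\<close>, and all derivatives up to order \<open>k\<close> are continuous up to \<open>t = 1\<close>.
  The notion is intended for open sets and for convex sets with nonempty interior, where the
  derivative within \<open>S\<close> is unique.
\<close>
primrec Ck_on ::
  "nat \<Rightarrow> 'a::euclidean_space set \<Rightarrow> ('a \<Rightarrow> 'b::real_normed_vector) \<Rightarrow> bool" where
  "Ck_on 0 S f \<longleftrightarrow> continuous_on S f"
| "Ck_on (Suc k) S f \<longleftrightarrow>
     (\<exists>g. (\<forall>x\<in>S. (f has_derivative (\<lambda>v. \<Sum>b\<in>Basis. (v \<bullet> b) *\<^sub>R g b x)) (at x within S)) \<and>
          (\<forall>b\<in>Basis. Ck_on k S (g b)))"

definition partial_deriv :: "'a::euclidean_space \<Rightarrow> ('a \<Rightarrow> real) \<Rightarrow> 'a \<Rightarrow> real" where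
  "partial_deriv b f x = deriv (\<lambda>s. f (x + s *\<^sub>R b)) 0"

definition laplacian :: "('a::euclidean_space \<Rightarrow> real) \<Rightarrow> 'a \<Rightarrow> real" where
  "laplacian f x = (\<Sum>b\<in>Basis. partial_deriv b (partial_deriv b f) x)"

definition fujita_exponent :: "real \<Rightarrow> real" where
  "fujita_exponent d = 1 + 2 / d"

text \<open>
  Classical solutions on \<open>[1,T) \<times> \<real>\<^sup>n\<close>; \<open>T = \<infinity>\<close> is a global solution. In the equation \<open>t > 1\<close>, so
  the two-sided \<^const>\<open>deriv\<close> depends only on \<open>u\<close> on \<open>[1,T)\<close>; at \<open>t = 1\<close> the time derivative
  is one-sided.
\<close>
definition classical_solution ::
  "real \<Rightarrow> real \<Rightarrow> real \<Rightarrow> real \<Rightarrow> ('a::euclidean_space \<Rightarrow> real) \<Rightarrow> ('a \<Rightarrow> real) \<Rightarrow>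
   ereal \<Rightarrow> (real \<Rightarrow> 'a \<Rightarrow> real) \<Rightarrow> bool" where
  "classical_solution \<alpha> \<mu> p \<epsilon> u0 u1 T u \<longleftrightarrow>
     1 < T \<and>
     Ck_on 2 ({t. 1 \<le> t \<and> ereal t < T} \<times> UNIV) (\<lambda>(t, x). u t x) \<and>
     (\<forall>t x. 1 < t \<and> ereal t < T \<longrightarrow>
        deriv (deriv (\<lambda>s. u s x)) t - 1 / (t powr (2 * \<alpha>)) * laplacian (u t) x
          + \<mu> / t * deriv (\<lambda>s. u s x) t = \<bar>u t x\<bar> powr p) \<and>
     (\<forall>x. u 1 x = \<epsilon> * u0 x) \<and>
     (\<forall>x. ((\<lambda>s. u s x) has_real_derivative \<epsilon> * u1 x) (at_right 1))"

definition lifespan ::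
  "real \<Rightarrow> real \<Rightarrow> real \<Rightarrow> ('a::euclidean_space \<Rightarrow> real) \<Rightarrow> ('a \<Rightarrow> real) \<Rightarrow> real \<Rightarrow> ereal" where
  "lifespan \<alpha> \<mu> p u0 u1 \<epsilon> = Sup {T. \<exists>u. classical_solution \<alpha> \<mu> p \<epsilon> u0 u1 T u}"

end

theory Submission
  imports Defs
begin

text \<open>
The spatial integral \<open>F t\<close> of a solution solves a scalar differential inequality that blows up at
the right time. Everything rests on \<open>u t\<close> having support in a ball of radius at most a
constant times \<open>t powr (1 - \<alpha>)\<close>. Then the integral of the Laplacian over space vanishes, so
\<open>F'' + \<mu> / t * F'\<close> is the integral of \<open>\<bar>u\<bar> powr p\<close>, and Jensen's inequality on the support gives
\<open>F'' + \<mu> / t * F' \<ge> c * t powr (- q) * \<bar>F\<bar> powr p\<close> with \<open>q = n * (1 - \<alpha>) * (p - 1)\<close>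
(lemma \<open>mass_satisfies_fujita_ode\<close>). The hypothesis \<open>p \<le> p_F\<close> says exactly \<open>q \<le> 2\<close>.

The support property is finite speed of propagation (lemma \<open>finite_propagation_speed\<close>).
It is proved by the energy method: with the weight \<open>(max 0 (\<rho>\<^sup>2 - \<bar>x - y\<bar>\<^sup>2))\<^sup>2\<close>, where the radius
\<open>\<rho>\<close> shrinks at the local sound speed \<open>t powr (- \<alpha>)\<close>, the weighted energy \<open>E\<close> satisfies
\<open>E' \<le> C * E\<close> and vanishes initially. The weight is continuously differentiable with
compact support, so that no integral over a moving domain has to be differentiated and the only
integration by parts needed is that a directional derivative of a compactly supported function has
integral zero; this in turn is translation invariance of the integral.

In the logarithmic time \<open>s = ln t\<close> the function \<open>G s = F (exp s)\<close> satisfies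
\<open>G'' + (\<mu> - 1) * G' \<ge> c * exp ((2 - q) * s) * G powr p\<close>. It is tested against a power of a linear
cut-off on \<open>{a..a + L}\<close>, and the term linear in \<open>G\<close> is absorbed by Young's inequality. This bounds
\<open>G\<close> and \<open>G'\<close> at \<open>a\<close> in terms of \<open>L\<close> and the coefficient
(lemma \<open>convex_ode_inequality_bound\<close>). The three lifespan estimates are three choices of the interval:
  \<^item> for \<open>q < 2\<close>, an interval of length one at the end of the time of existence, where the coefficient is
    as large as possible, compared with \<open>F \<ge> F 1 \<sim> \<epsilon>\<close>;
  \<^item> for \<open>q = 2\<close> and \<open>\<mu> > 1\<close>, the whole interval from \<open>s = 0\<close>, where the first-order damping term
    dominates;
  \<^item> for \<open>q = 2\<close> and \<open>\<mu> \<le> 1\<close>, again the whole interval, but with the damping term dropped, and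
    compared with \<open>F' 1 \<sim> \<epsilon>\<close>.
\<close>

section \<open>Differentiation and integration\<close>

lemma mean_value_within:
  fixes f f' :: "real \<Rightarrow> real"
  assumes "a < b" "\<And>t. t \<in> {a..b} \<Longrightarrow> (f has_real_derivative f' t) (at t within {a..b})"
  shows "\<exists>s. a < s \<and> s < b \<and> f b - f a = (b - a) * f' s"
  using mvt_simple[of a b f "\<lambda>t. (*) (f' t)"] assms
  by (auto simp: has_field_derivative_def mult.commute)

text \<open>
Large cubes take the place of large balls, so that volumes are plain powers and the Leibniz rule
for \<^const>\<open>cbox\<close> applies directly.
\<close>
definition centred_box :: "real \<Rightarrow> 'a::euclidean_space set" where
  "centred_box r = cbox (- (r *\<^sub>R One)) (r *\<^sub>R One)"

lemma mem_centred_box: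
  fixes x :: "'a::euclidean_space"
  assumes "norm x \<le> r" shows "x \<in> centred_box r"
  unfolding centred_box_def mem_box
proof
  fix b :: 'a assume b: "b \<in> Basis"
  have "\<bar>x \<bullet> b\<bar> \<le> r" using Basis_le_norm[OF b, of x] assms by linarith
  then show "- (r *\<^sub>R One) \<bullet> b \<le> x \<bullet> b \<and> x \<bullet> b \<le> r *\<^sub>R One \<bullet> b"
    using b by (auto simp: inner_sum_left_Basis)
qed

lemma content_centred_box:
  assumes "0 \<le> r" shows "measure lborel (centred_box r :: 'a::euclidean_space set) = (2 * r) ^ DIM('a)"
proof -
  have "measure lborel (centred_box r :: 'a set) = (\<Prod>b\<in>(Basis::'a set). (r *\<^sub>R One) \<bullet> b - (- (r *\<^sub>R One)) \<bullet> b)"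
    unfolding centred_box_def using assms by (intro content_cbox) (simp add: inner_sum_left_Basis)
  also have "\<dots> = (\<Prod>b\<in>(Basis::'a set). 2 * r)"
    by (rule prod.cong) (auto simp: inner_sum_left_Basis)
  finally show ?thesis by simp
qed

lemma DERIV_eq_on:
  fixes f g :: "real \<Rightarrow> real"
  assumes "x \<in> S" "\<And>y. y \<in> S \<Longrightarrow> g y = f y" "(f has_real_derivative d) (at x within S)"
  shows "(g has_real_derivative d) (at x within S)"
  using assms unfolding has_field_derivative_def by (rule has_derivative_transform)

lemma DERIV_directional:
  fixes f d :: "'a::real_vector \<Rightarrow> real"
  assumes "\<And>x. ((\<lambda>s. f (x + s *\<^sub>R b)) has_real_derivative d x) (at 0)"
  shows "((\<lambda>s. f (x + s *\<^sub>R b)) has_real_derivative d (x + s *\<^sub>R b)) (at s)"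
proof -
  have "((\<lambda>\<sigma>. f ((x + s *\<^sub>R b) + \<sigma> *\<^sub>R b)) has_real_derivative d (x + s *\<^sub>R b)) (at 0)" by (rule assms)
  then have "((\<lambda>\<sigma>. f (x + (\<sigma> + s) *\<^sub>R b)) has_real_derivative d (x + s *\<^sub>R b)) (at 0)"
    by (simp add: algebra_simps)
  then show ?thesis using DERIV_shift[of "\<lambda>\<sigma>. f (x + \<sigma> *\<^sub>R b)" _ 0 s] by simp
qed

text \<open>
The integral of \<open>f (x + s *\<^sub>R b)\<close> over a large cube does not depend on \<open>s\<close> for \<open>\<bar>s\<bar> < 1\<close>, by
translation invariance: the margin of width one keeps the shifted support inside the cube.
Differentiating at \<open>s = 0\<close> gives the claim. This replaces the divergence theorem below.
\<close>
lemma integral_directional_derivative_eq_0: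
  fixes f g :: "'a::euclidean_space \<Rightarrow> real"
  assumes b: "b \<in> Basis"
    and der: "\<And>x. ((\<lambda>s. f (x + s *\<^sub>R b)) has_real_derivative g x) (at 0)"
    and cf: "continuous_on UNIV f" and cg: "continuous_on UNIV g"
    and supp: "\<And>x. r < norm x \<Longrightarrow> f x = 0" and R: "r + 1 \<le> R"
  shows "integral (centred_box R) g = 0"
proof -
  have nb: "norm b = 1" using b by simp
  have const: "integral (centred_box R) (\<lambda>x. f (x + s *\<^sub>R b)) = integral UNIV f"
    if s: "s \<in> {-1<..<1}" for s
  proof -
    let ?a = "- (R *\<^sub>R One) :: 'a" let ?e = "R *\<^sub>R One :: 'a" let ?c = "s *\<^sub>R b"
    have i1: "(f has_integral integral (cbox (?a + ?c) (?e + ?c)) f) (cbox (?a + ?c) (?e + ?c))"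
      using cf by (intro integrable_integral integrable_continuous) (auto intro: continuous_on_subset)
    have out: "f x = 0" if "x \<notin> cbox (?a + ?c) (?e + ?c)" for x
    proof -
      have "x - ?c \<notin> centred_box R" using that by (auto simp: centred_box_def mem_box algebra_simps)
      then have "R < norm (x - ?c)" using mem_centred_box[of "x - ?c" R] by force
      also have "\<dots> \<le> norm x + \<bar>s\<bar>" using norm_triangle_ineq4[of x ?c] nb by simp
      finally show ?thesis using s R by (intro supp) auto
    qed
    have "(f has_integral integral (cbox (?a + ?c) (?e + ?c)) f) UNIV"
      by (rule has_integral_on_superset[OF i1 out]) auto
    then have "integral UNIV f = integral (cbox (?a + ?c) (?e + ?c)) f" by (rule integral_unique)
    also have "\<dots> = integral (cbox ?a ?e) (f \<circ> ((+) ?c))" by (simp only: integral_shift_cbox_plus)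
    also have "f \<circ> ((+) ?c) = (\<lambda>x. f (x + ?c))" by (auto simp: add.commute)
    finally show ?thesis by (simp add: centred_box_def)
  qed
  have "((\<lambda>s. integral (centred_box R) (\<lambda>x. f (x + s *\<^sub>R b))) has_real_derivative
      integral (centred_box R) (\<lambda>x. g (x + 0 *\<^sub>R b))) (at 0 within {-1<..<1})"
    unfolding centred_box_def
  proof (rule leibniz_rule_field_derivative)
    fix s :: real and x :: 'a
    show "((\<lambda>s. f (x + s *\<^sub>R b)) has_real_derivative g (x + s *\<^sub>R b)) (at s within {-1<..<1})"
      by (rule has_field_derivative_at_within, rule DERIV_directional, rule der)
    show "(\<lambda>x. f (x + s *\<^sub>R b)) integrable_on cbox (- (R *\<^sub>R One)) (R *\<^sub>R One)"
      by (intro integrable_continuous continuous_on_compose2[OF cf] continuous_intros) auto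
    show "continuous_on ({- 1<..<1} \<times> cbox (- (R *\<^sub>R One)) (R *\<^sub>R One)) (\<lambda>(s, x). g (x + s *\<^sub>R b))"
      unfolding split_beta by (intro continuous_on_compose2[OF cg] continuous_intros) auto
  qed auto
  moreover have "((\<lambda>s. integral (centred_box R) (\<lambda>x. f (x + s *\<^sub>R b))) has_real_derivative 0)
      (at 0 within {-1<..<1})"
    by (rule DERIV_eq_on[where f="\<lambda>_. integral UNIV f"]) (auto simp: const)
  ultimately show ?thesis
    by (simp add: at_within_open[of "0::real" "{-1<..<1}"] DERIV_unique)
qed

text \<open>
Write \<open>w t \<sigma>\<close> as \<open>w t (s - 1)\<close> plus the integral of \<open>p t\<close>, differentiate in \<open>t\<close> under the integral
sign, and differentiate the result in \<open>\<sigma>\<close>. The derivatives in \<open>t\<close> are taken within \<open>I\<close>, which may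
contain endpoints, so the rule also holds at the initial time.
\<close>
lemma mixed_partial_commute:
  fixes w p q r :: "real \<Rightarrow> real \<Rightarrow> real"
  assumes I: "convex I" "\<And>t. t \<in> I \<Longrightarrow> at t within I \<noteq> bot" and t: "t \<in> I"
    and w_s: "\<And>t s. t \<in> I \<Longrightarrow> (w t has_real_derivative p t s) (at s)"
    and w_t: "\<And>t s. t \<in> I \<Longrightarrow> ((\<lambda>t. w t s) has_real_derivative r t s) (at t within I)"
    and p_t: "\<And>t s. t \<in> I \<Longrightarrow> ((\<lambda>t. p t s) has_real_derivative q t s) (at t within I)"
    and cp: "\<And>t. t \<in> I \<Longrightarrow> continuous_on UNIV (p t)"
    and cq: "continuous_on (I \<times> UNIV) (\<lambda>(t, s). q t s)"
  shows "(r t has_real_derivative q t s) (at s)"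
proof -
  let ?a = "s - 1"
  have cqt: "continuous_on UNIV (q t)"
    using continuous_on_compose2[OF cq, of UNIV "\<lambda>s. (t, s)"] t by (force intro!: continuous_intros)
  have r: "r t \<sigma> = r t ?a + integral {?a..\<sigma>} (q t)" if \<sigma>: "?a \<le> \<sigma>" for \<sigma>
  proof -
    have ftc: "w \<tau> ?a + integral {?a..\<sigma>} (p \<tau>) = w \<tau> \<sigma>" if "\<tau> \<in> I" for \<tau>
    proof -
      have "(p \<tau> has_integral (w \<tau> \<sigma> - w \<tau> ?a)) {?a..\<sigma>}"
        using w_s[OF that] \<sigma> by (intro fundamental_theorem_of_calculus)
          (auto simp: has_real_derivative_iff_has_vector_derivative[symmetric] intro: has_field_derivative_at_within)
      then show ?thesis by (simp add: integral_unique)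
    qed
    have "((\<lambda>\<tau>. integral (cbox ?a \<sigma>) (p \<tau>)) has_real_derivative integral (cbox ?a \<sigma>) (q t)) (at t within I)"
      using p_t cp cq t I(1)
      by (intro leibniz_rule_field_derivative integrable_continuous)
        (auto intro: continuous_on_subset)
    then have "((\<lambda>\<tau>. w \<tau> ?a + integral {?a..\<sigma>} (p \<tau>)) has_real_derivative
        r t ?a + integral {?a..\<sigma>} (q t)) (at t within I)"
      using w_t[OF t, of ?a] by (auto intro!: derivative_intros)
    then have "((\<lambda>\<tau>. w \<tau> \<sigma>) has_real_derivative r t ?a + integral {?a..\<sigma>} (q t)) (at t within I)"
      by (rule DERIV_eq_on[OF t, rotated]) (simp add: ftc)
    then show ?thesis using w_t[OF t, of \<sigma>] I(2)[OF t] has_field_derivative_unique by blast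
  qed
  have "((\<lambda>\<sigma>. integral {?a..\<sigma>} (q t)) has_real_derivative q t s) (at s within {?a..s+1})"
    using cqt by (intro integral_has_real_derivative) (auto intro: continuous_on_subset)
  then have "((\<lambda>\<sigma>. r t ?a + integral {?a..\<sigma>} (q t)) has_real_derivative q t s) (at s within {?a..s+1})"
    by (auto intro!: derivative_eq_intros)
  then have "(r t has_real_derivative q t s) (at s within {?a..s+1})"
    by (rule DERIV_eq_on[rotated 2]) (auto simp: r[symmetric])
  then show ?thesis by (simp add: at_within_Icc_at)
qed

text \<open>
The square makes the positive part continuously differentiable; the energy weight below is
of this form.
\<close>
lemma DERIV_square_max_0: "((\<lambda>s. (max 0 s)\<^sup>2) has_real_derivative 2 * max 0 s) (at s)"
proof (cases s "0::real" rule: linorder_cases)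
  case less
  have "((\<lambda>s. 0) has_real_derivative 2 * max 0 s) (at s)" using less by simp
  then show ?thesis
    by (rule has_field_derivative_transform_within_open[where S="{..<0}"]) (use less in auto)
next
  case greater
  have "((\<lambda>s. s\<^sup>2) has_real_derivative 2 * max 0 s) (at s)" using greater by (auto intro!: derivative_eq_intros)
  then show ?thesis
    by (rule has_field_derivative_transform_within_open[where S="{0<..}"]) (use greater in auto)
next
  case equal
  have "((\<lambda>h::real. (max 0 h)\<^sup>2 / h) \<longlongrightarrow> 0) (at 0)"
  proof (rule Lim_null_comparison)
    show "((\<lambda>h::real. \<bar>h\<bar>) \<longlongrightarrow> 0) (at 0)" by (intro tendsto_eq_intros) auto
    show "\<forall>\<^sub>F h::real in at 0. norm ((max 0 h)\<^sup>2 / h) \<le> \<bar>h\<bar>"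
      by (auto simp: max_def power2_eq_square intro!: always_eventually)
  qed
  then show ?thesis using equal by (simp add: DERIV_def)
qed

text \<open>
Translates the derivative within \<open>I \<times> UNIV\<close>, as in \<^const>\<open>Ck_on\<close>, into a time derivative within \<open>I\<close>
and two-sided spatial derivatives.
\<close>
lemma partials_of_total_derivative:
  fixes f :: "real \<times> 'a::euclidean_space \<Rightarrow> real"
  assumes der: "(f has_derivative (\<lambda>v. \<Sum>b\<in>Basis. (v \<bullet> b) *\<^sub>R g b (t, x))) (at (t, x) within I \<times> UNIV)"
    and t: "t \<in> I"
  shows "((\<lambda>s. f (s, x)) has_real_derivative g (1, 0) (t, x)) (at t within I)"
    and "b \<in> Basis \<Longrightarrow> ((\<lambda>s. f (t, x + s *\<^sub>R b)) has_real_derivative g (0, b) (t, x)) (at 0)"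
proof -
  have ev: "(\<Sum>b\<in>Basis. ((h *\<^sub>R e) \<bullet> b) *\<^sub>R g b (t, x)) = h * g e (t, x)"
    if "e \<in> Basis" for h and e :: "real \<times> 'a"
    using that by (simp add: inner_Basis if_distrib if_distribR sum.delta cong: if_cong)
  have e1: "(1, 0) \<in> (Basis :: (real \<times> 'a) set)" by (simp add: Basis_prod_def)
  have "((\<lambda>s. f (s, x)) has_derivative (\<lambda>h. \<Sum>b\<in>Basis. ((h *\<^sub>R (1, 0)) \<bullet> b) *\<^sub>R g b (t, x))) (at t within I)"
    by (rule has_derivative_in_compose[where f="\<lambda>s. (s, x)"])
      (auto intro!: derivative_eq_intros has_derivative_subset[OF der[unfolded real_scaleR_def]] simp: t)
  then show "((\<lambda>s. f (s, x)) has_real_derivative g (1, 0) (t, x)) (at t within I)"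
    unfolding ev[OF e1] has_field_derivative_def by (simp add: mult_commute_abs)
  assume b: "b \<in> Basis"
  have e2: "(0, b) \<in> (Basis :: (real \<times> 'a) set)" using b by (simp add: Basis_prod_def)
  have "((\<lambda>s. f (t, x + s *\<^sub>R b)) has_derivative (\<lambda>h. \<Sum>c\<in>Basis. ((h *\<^sub>R (0, b)) \<bullet> c) *\<^sub>R g c (t, x))) (at 0)"
    by (rule has_derivative_in_compose[where f="\<lambda>s. (t, x + s *\<^sub>R b)"])
      (auto intro!: derivative_eq_intros has_derivative_subset[OF der[unfolded real_scaleR_def]] simp: t)
  then show "((\<lambda>s. f (t, x + s *\<^sub>R b)) has_real_derivative g (0, b) (t, x)) (at 0)"
    unfolding ev[OF e2] has_field_derivative_def by (simp add: mult_commute_abs)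
qed

section \<open>Classical solutions through their partial derivatives\<close>

definition time_interval :: "ereal \<Rightarrow> real set" where
  "time_interval T = {t. 1 \<le> t \<and> ereal t < T}"

lemma ereal_le_less_trans: "x \<le> y \<Longrightarrow> ereal y < T \<Longrightarrow> ereal x < T"
  by (meson ereal_less_eq(3) order.strict_trans1)

lemma convex_time_interval: "convex (time_interval T)"
  unfolding is_interval_convex_1[symmetric] is_interval_1 time_interval_def
  using ereal_le_less_trans by auto

lemma time_interval_nontrivial:
  assumes "t \<in> time_interval T" shows "at t within time_interval T \<noteq> bot"
proof -
  obtain r where r: "t < r" "ereal r < T"
    using ereal_dense2[of "ereal t" T] assms by (auto simp: time_interval_def)
  have "{t<..<r} \<subseteq> time_interval T"
    using assms r by (auto simp: time_interval_def) (meson ereal_less_eq(3) less_imp_le order.strict_trans1)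
  then have "t islimpt time_interval T"
    using islimpt_greaterThanLessThan1[OF r(1)] islimpt_subset by blast
  then show ?thesis by (simp add: trivial_limit_within)
qed

lemma Icc_subset_time_interval: "t \<in> time_interval T \<Longrightarrow> {1..t} \<subseteq> time_interval T"
  by (auto simp: time_interval_def) (meson ereal_less_eq(3) order.strict_trans1)

lemma open_time_interval: "open {t. 1 < t \<and> ereal t < T}"
proof -
  have "{t. 1 < t \<and> ereal t < T} = {1<..} \<inter> ereal -` {..<T}" by auto
  then show ?thesis by (auto intro!: open_Int open_vimage continuous_intros)
qed

lemma at_within_time_interval:
  assumes "1 < t" "ereal t < T" shows "at t within time_interval T = at t"
proof (rule at_within_open_subset)
  show "t \<in> {t. 1 < t \<and> ereal t < T}" using assms by simp
qed (auto simp: open_time_interval time_interval_def)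

text \<open>
A solution together with all the partial derivatives that the energy method uses: \<open>D b\<close> and \<open>DD b\<close> are
the first and second derivatives of \<open>u\<close> in direction \<open>b\<close>, and \<open>Dt b\<close> is at the same time the
time derivative of \<open>D b\<close> and the derivative of \<open>ut\<close> in direction \<open>b\<close>. Time derivatives are taken
within the time interval and are therefore one-sided at \<open>t = 1\<close>.
\<close>
locale damped_wave =
  fixes T :: ereal and \<alpha> \<mu> p \<epsilon> :: real and u0 u1 :: "'a::euclidean_space \<Rightarrow> real"
    and u ut utt :: "real \<Rightarrow> 'a \<Rightarrow> real" and D DD Dt :: "'a \<Rightarrow> real \<Rightarrow> 'a \<Rightarrow> real"
  assumes T: "1 < T"
    and u_t: "\<And>t x. t \<in> time_interval T \<Longrightarrow>
      ((\<lambda>s. u s x) has_real_derivative ut t x) (at t within time_interval T)"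
    and ut_t: "\<And>t x. t \<in> time_interval T \<Longrightarrow>
      ((\<lambda>s. ut s x) has_real_derivative utt t x) (at t within time_interval T)"
    and D_t: "\<And>b t x. b \<in> Basis \<Longrightarrow> t \<in> time_interval T \<Longrightarrow>
      ((\<lambda>s. D b s x) has_real_derivative Dt b t x) (at t within time_interval T)"
    and u_x: "\<And>b t x. b \<in> Basis \<Longrightarrow> t \<in> time_interval T \<Longrightarrow>
      ((\<lambda>s. u t (x + s *\<^sub>R b)) has_real_derivative D b t x) (at 0)"
    and D_x: "\<And>b t x. b \<in> Basis \<Longrightarrow> t \<in> time_interval T \<Longrightarrow>
      ((\<lambda>s. D b t (x + s *\<^sub>R b)) has_real_derivative DD b t x) (at 0)"
    and ut_x: "\<And>b t x. b \<in> Basis \<Longrightarrow> t \<in> time_interval T \<Longrightarrow>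
      ((\<lambda>s. ut t (x + s *\<^sub>R b)) has_real_derivative Dt b t x) (at 0)"
    and cont_u: "continuous_on (time_interval T \<times> UNIV) (\<lambda>(t, x). u t x)"
    and cont_ut: "continuous_on (time_interval T \<times> UNIV) (\<lambda>(t, x). ut t x)"
    and cont_utt: "continuous_on (time_interval T \<times> UNIV) (\<lambda>(t, x). utt t x)"
    and cont_D: "\<And>b. b \<in> Basis \<Longrightarrow> continuous_on (time_interval T \<times> UNIV) (\<lambda>(t, x). D b t x)"
    and cont_DD: "\<And>b. b \<in> Basis \<Longrightarrow> continuous_on (time_interval T \<times> UNIV) (\<lambda>(t, x). DD b t x)"
    and cont_Dt: "\<And>b. b \<in> Basis \<Longrightarrow> continuous_on (time_interval T \<times> UNIV) (\<lambda>(t, x). Dt b t x)"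
    and wave: "\<And>t x. 1 < t \<Longrightarrow> ereal t < T \<Longrightarrow>
      utt t x - 1 / (t powr (2 * \<alpha>)) * (\<Sum>b\<in>Basis. DD b t x) + \<mu> / t * ut t x = \<bar>u t x\<bar> powr p"
    and init_u: "\<And>x. u 1 x = \<epsilon> * u0 x"
    and init_ut: "\<And>x. ut 1 x = \<epsilon> * u1 x"

text \<open>
The functions are the components of the derivatives given by \<^const>\<open>Ck_on\<close>; the symmetry built into
\<open>Dt\<close> is the equality of the mixed partial derivatives.
\<close>
lemma classical_solution_imp_damped_wave:
  fixes u :: "real \<Rightarrow> 'a::euclidean_space \<Rightarrow> real"
  assumes sol: "classical_solution \<alpha> \<mu> p \<epsilon> u0 u1 T u"
  obtains ut utt D DD Dt where "damped_wave T \<alpha> \<mu> p \<epsilon> u0 u1 u ut utt D DD Dt"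
proof -
  let ?I = "time_interval T"
  let ?f = "\<lambda>(t, x). u t x"
  have T: "1 < T" and C2: "Ck_on 2 (?I \<times> UNIV) ?f"
    and pde: "\<And>t x. 1 < t \<Longrightarrow> ereal t < T \<Longrightarrow>
        deriv (deriv (\<lambda>s. u s x)) t - 1 / (t powr (2 * \<alpha>)) * laplacian (u t) x
          + \<mu> / t * deriv (\<lambda>s. u s x) t = \<bar>u t x\<bar> powr p"
    and iu: "\<And>x. u 1 x = \<epsilon> * u0 x"
    and iut: "\<And>x. ((\<lambda>s. u s x) has_real_derivative \<epsilon> * u1 x) (at_right 1)"
    using sol by (auto simp: classical_solution_def time_interval_def)
  obtain g where g: "\<And>z. z \<in> ?I \<times> UNIV \<Longrightarrow>
        (?f has_derivative (\<lambda>v. \<Sum>b\<in>Basis. (v \<bullet> b) *\<^sub>R g b z)) (at z within ?I \<times> UNIV)"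
      and C1: "\<And>b. b \<in> Basis \<Longrightarrow> Ck_on 1 (?I \<times> UNIV) (g b)"
    using C2 unfolding numeral_2_eq_2 One_nat_def Ck_on.simps(2)[of "Suc 0"] by blast
  have "\<forall>b\<in>Basis. \<exists>h. (\<forall>z\<in>?I \<times> UNIV.
        (g b has_derivative (\<lambda>v. \<Sum>c\<in>Basis. (v \<bullet> c) *\<^sub>R h c z)) (at z within ?I \<times> UNIV)) \<and>
          (\<forall>c\<in>Basis. continuous_on (?I \<times> UNIV) (h c))"
    using C1 by simp
  from bchoice[OF this] obtain h where h': "\<forall>b\<in>Basis. (\<forall>z\<in>?I \<times> UNIV.
        (g b has_derivative (\<lambda>v. \<Sum>c\<in>Basis. (v \<bullet> c) *\<^sub>R h b c z)) (at z within ?I \<times> UNIV)) \<and>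
          (\<forall>c\<in>Basis. continuous_on (?I \<times> UNIV) (h b c))" ..
  have h: "\<And>b z. b \<in> Basis \<Longrightarrow> z \<in> ?I \<times> UNIV \<Longrightarrow>
        (g b has_derivative (\<lambda>v. \<Sum>c\<in>Basis. (v \<bullet> c) *\<^sub>R h b c z)) (at z within ?I \<times> UNIV)"
    and ch: "\<And>b c. b \<in> Basis \<Longrightarrow> c \<in> Basis \<Longrightarrow> continuous_on (?I \<times> UNIV) (h b c)"
    using h' by blast+
  have cf: "continuous_on (?I \<times> UNIV) ?f"
    unfolding continuous_on_eq_continuous_within using g has_derivative_continuous by blast
  have cg: "continuous_on (?I \<times> UNIV) (g b)" if "b \<in> Basis" for b
    unfolding continuous_on_eq_continuous_within using h[OF that] has_derivative_continuous by blast
  have e1: "(1, 0) \<in> (Basis :: (real \<times> 'a) set)" by (simp add: Basis_prod_def)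
  have e2: "(0, b) \<in> (Basis :: (real \<times> 'a) set)" if "b \<in> Basis" for b
    using that by (simp add: Basis_prod_def)
  define ut where "ut t x = g (1, 0) (t, x)" for t x
  define utt where "utt t x = h (1, 0) (1, 0) (t, x)" for t x
  define D where "D b t x = g (0, b) (t, x)" for b t x
  define DD where "DD b t x = h (0, b) (0, b) (t, x)" for b t x
  define Dt where "Dt b t x = h (0, b) (1, 0) (t, x)" for b t x
  have zI: "(t, x) \<in> ?I \<times> UNIV" if "t \<in> ?I" for t and x :: 'a using that by simp
  have u_t: "((\<lambda>s. u s x) has_real_derivative ut t x) (at t within ?I)" if "t \<in> ?I" for t x
    using partials_of_total_derivative(1)[where g=g, OF g[OF zI[OF that]] that] by (simp add: ut_def)
  have ut_t: "((\<lambda>s. ut s x) has_real_derivative utt t x) (at t within ?I)" if "t \<in> ?I" for t x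
    using partials_of_total_derivative(1)[where g="h (1, 0)", OF h[OF e1 zI[OF that]] that] by (simp add: ut_def utt_def)
  have D_t: "((\<lambda>s. D b s x) has_real_derivative Dt b t x) (at t within ?I)"
    if "b \<in> Basis" "t \<in> ?I" for b t x
    using partials_of_total_derivative(1)[where g="h (0, b)", OF h[OF e2[OF that(1)] zI[OF that(2)]] that(2)] by (simp add: D_def Dt_def)
  have u_x: "((\<lambda>s. u t (x + s *\<^sub>R b)) has_real_derivative D b t x) (at 0)"
    if "b \<in> Basis" "t \<in> ?I" for b t x
    using partials_of_total_derivative(2)[where g=g, OF g[OF zI[OF that(2)]] that(2,1)] by (simp add: D_def)
  have D_x: "((\<lambda>s. D b t (x + s *\<^sub>R b)) has_real_derivative DD b t x) (at 0)"
    if "b \<in> Basis" "t \<in> ?I" for b t x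
    using partials_of_total_derivative(2)[where g="h (0, b)", OF h[OF e2[OF that(1)] zI[OF that(2)]] that(2,1)]
    by (simp add: D_def DD_def)
  have ut_x: "((\<lambda>s. ut t (x + s *\<^sub>R b)) has_real_derivative Dt b t x) (at 0)"
    if b: "b \<in> Basis" and t: "t \<in> ?I" for b t x
  proof -
    have "((\<lambda>s. ut t (x + s *\<^sub>R b)) has_real_derivative Dt b t (x + 0 *\<^sub>R b)) (at 0)"
    proof (rule mixed_partial_commute[OF convex_time_interval time_interval_nontrivial t])
      fix t s assume t: "t \<in> ?I"
      show "((\<lambda>s. u t (x + s *\<^sub>R b)) has_real_derivative D b t (x + s *\<^sub>R b)) (at s)"
        by (rule DERIV_directional[OF u_x[OF b t]])
      show "((\<lambda>t. u t (x + s *\<^sub>R b)) has_real_derivative ut t (x + s *\<^sub>R b)) (at t within ?I)"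
        by (rule u_t[OF t])
      show "((\<lambda>t. D b t (x + s *\<^sub>R b)) has_real_derivative Dt b t (x + s *\<^sub>R b)) (at t within ?I)"
        by (rule D_t[OF b t])
      show "continuous_on UNIV (\<lambda>s. D b t (x + s *\<^sub>R b))"
        unfolding D_def using t
        by (intro continuous_on_compose2[OF cg[OF e2[OF b]]] continuous_intros) auto
    next
      show "continuous_on (?I \<times> UNIV) (\<lambda>(t, s). Dt b t (x + s *\<^sub>R b))"
        unfolding Dt_def split_beta
        by (intro continuous_on_compose2[OF ch[OF e2[OF b] e1]] continuous_intros) auto
    qed
    then show ?thesis by simp
  qed
  have tI: "t \<in> ?I" if "1 < t" "ereal t < T" for t using that by (simp add: time_interval_def)
  have dut: "deriv (\<lambda>s. u s x) t = ut t x" if "1 < t" "ereal t < T" for t x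
    using u_t[OF tI[OF that]] by (simp add: at_within_time_interval[OF that] DERIV_imp_deriv)
  have dutt: "deriv (deriv (\<lambda>s. u s x)) t = utt t x" if t: "1 < t" "ereal t < T" for t x
  proof (rule DERIV_imp_deriv, rule has_field_derivative_transform_within_open)
    show "((\<lambda>s. ut s x) has_real_derivative utt t x) (at t)"
      using ut_t[OF tI[OF t]] by (simp add: at_within_time_interval[OF t])
  qed (use t open_time_interval[of T] dut in auto)
  have dD: "partial_deriv b (u t) = D b t" if "b \<in> Basis" "t \<in> ?I" for b t
    using DERIV_imp_deriv[OF u_x[OF that]] by (auto simp: partial_deriv_def)
  have dDD: "partial_deriv b (D b t) x = DD b t x" if "b \<in> Basis" "t \<in> ?I" for b t x
    using DERIV_imp_deriv[OF D_x[OF that]] by (auto simp: partial_deriv_def)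
  have lap: "laplacian (u t) x = (\<Sum>b\<in>Basis. DD b t x)" if "t \<in> ?I" for t x
    unfolding laplacian_def by (rule sum.cong) (auto simp: dD dDD that)
  have one: "1 \<in> ?I" using T by (simp add: time_interval_def one_ereal_def)
  have iut': "ut 1 x = \<epsilon> * u1 x" for x
  proof -
    obtain r where r: "1 < r" "ereal r < T" using ereal_dense2[OF T] by (auto simp: one_ereal_def)
    have sub: "{1<..<r} \<subseteq> ?I" "{1<..<r} \<subseteq> {1<..}"
      using r by (auto simp: time_interval_def) (meson ereal_less_eq(3) less_imp_le order.strict_trans1)
    have "at 1 within {1<..<r} \<noteq> bot"
      using islimpt_greaterThanLessThan1[OF r(1)] by (simp add: trivial_limit_within)
    then show ?thesis
      using has_field_derivative_subset[OF u_t[OF one] sub(1)] has_field_derivative_subset[OF iut sub(2)]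
        has_field_derivative_unique by blast
  qed
  have "damped_wave T \<alpha> \<mu> p \<epsilon> u0 u1 u ut utt D DD Dt"
  proof unfold_locales
    show "continuous_on (?I \<times> UNIV) (\<lambda>(t, x). ut t x)"
      using cg[OF e1] by (simp add: ut_def)
    show "continuous_on (?I \<times> UNIV) (\<lambda>(t, x). utt t x)"
      using ch[OF e1 e1] by (simp add: utt_def)
    fix b :: 'a assume b: "b \<in> Basis"
    show "continuous_on (?I \<times> UNIV) (\<lambda>(t, x). D b t x)"
      using cg[OF e2[OF b]] by (simp add: D_def)
    show "continuous_on (?I \<times> UNIV) (\<lambda>(t, x). DD b t x)"
      using ch[OF e2[OF b] e2[OF b]] by (simp add: DD_def)
    show "continuous_on (?I \<times> UNIV) (\<lambda>(t, x). Dt b t x)"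
      using ch[OF e2[OF b] e1] by (simp add: Dt_def)
  next
    fix t x assume t: "1 < t" "ereal t < T"
    show "utt t x - 1 / (t powr (2 * \<alpha>)) * (\<Sum>b\<in>Basis. DD b t x) + \<mu> / t * ut t x = \<bar>u t x\<bar> powr p"
      using pde[OF t, of x] by (simp add: dut dutt lap t tI)
  qed (use T u_t ut_t D_t u_x D_x ut_x cf iu iut' in auto)
  then show thesis by (rule that)
qed

section \<open>Blow-up of a scalar differential inequality\<close>

text \<open>
A form of Young's inequality without the optimal constant. Either the power term already dominates
the linear one, or \<open>a powr (p - 1) < x / \<kappa>\<close>, and then \<open>a * x\<close> alone is below the right-hand side.
\<close>
lemma linear_minus_power_le:
  fixes a x \<kappa> p :: real
  assumes p: "1 < p" and a: "0 \<le> a" and x: "0 < x" and \<kappa>: "0 < \<kappa>"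
  shows "a * x - \<kappa> * a powr p \<le> \<kappa> powr (- 1 / (p - 1)) * x powr (p / (p - 1))"
proof (cases "x \<le> \<kappa> * a powr (p - 1)")
  case True
  have "a powr p = a * a powr (p - 1)"
    using a powr_add[of a 1 "p - 1"] by (cases "a = 0") auto
  then have "\<kappa> * a powr p = a * (\<kappa> * a powr (p - 1))" by simp
  also have "\<dots> \<ge> a * x" using True a by (rule mult_left_mono)
  finally have "a * x - \<kappa> * a powr p \<le> 0" by simp
  also have "0 \<le> \<kappa> powr (- 1 / (p - 1)) * x powr (p / (p - 1))" by simp
  finally show ?thesis .
next
  case False
  then have "a powr (p - 1) \<le> x / \<kappa>" using \<kappa> by (simp add: field_simps)
  then have "(a powr (p - 1)) powr (1 / (p - 1)) \<le> (x / \<kappa>) powr (1 / (p - 1))"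
    using p by (intro powr_mono2) auto
  then have "a \<le> (x / \<kappa>) powr (1 / (p - 1))"
    using p a by (simp add: powr_powr)
  also have "\<dots> = \<kappa> powr (- 1 / (p - 1)) * x powr (1 / (p - 1))"
    using x \<kappa> by (simp add: powr_divide powr_minus field_simps)
  finally have "a * x \<le> \<kappa> powr (- 1 / (p - 1)) * x powr (1 / (p - 1)) * x"
    using x by (intro mult_right_mono) auto
  moreover have "x powr (1 / (p - 1)) * x = x powr (p / (p - 1))"
  proof -
    have "p / (p - 1) = 1 / (p - 1) + 1" using p by (simp add: field_simps)
    then show ?thesis using x by (simp add: powr_add)
  qed
  ultimately have "a * x \<le> \<kappa> powr (- 1 / (p - 1)) * x powr (p / (p - 1))"
    by (simp only: mult.assoc)
  moreover have "0 \<le> \<kappa> * a powr p" using \<kappa> by simp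
  ultimately show ?thesis by linarith
qed

text \<open>
The inequality is tested against \<open>\<eta> s = (1 - (s - a) / L) ^ k\<close>. The boundary expression
\<open>N = G' * \<eta> + m * G * \<eta> - G * \<eta>'\<close> vanishes at the right endpoint, equals the left-hand side of the
claim at \<open>a\<close>, and satisfies \<open>N' = (G'' + m * G') * \<eta> - G * (\<eta>'' - m * \<eta>')\<close>. The lower bound on
\<open>G'' + m * G'\<close> absorbs the last term by Young's inequality, leaving a constant multiple of
\<open>\<sigma> powr (k - 2 * p / (p - 1))\<close> with \<open>\<sigma> = 1 - (s - a) / L\<close>; this stays bounded because of the lower
bound on \<open>k\<close>.
\<close>
lemma convex_ode_inequality_bound:
  fixes G G' G'' :: "real \<Rightarrow> real" and k :: nat and p \<kappa> m L a :: real
  assumes p: "1 < p" and \<kappa>: "0 < \<kappa>" and m: "0 \<le> m" and L: "0 < L"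
    and k: "2 * p / (p - 1) \<le> real k"
    and G: "\<And>s. s \<in> {a..a + L} \<Longrightarrow> (G has_real_derivative G' s) (at s within {a..a + L})"
    and G': "\<And>s. s \<in> {a..a + L} \<Longrightarrow> (G' has_real_derivative G'' s) (at s within {a..a + L})"
    and pos: "\<And>s. s \<in> {a..a + L} \<Longrightarrow> 0 \<le> G s"
    and ineq: "\<And>s. a < s \<Longrightarrow> s < a + L \<Longrightarrow> \<kappa> * G s powr p \<le> G'' s + m * G' s"
  shows "G' a + (m + k / L) * G a
    \<le> L * (\<kappa> powr (- 1 / (p - 1)) * (m * k / L + real k * (real k - 1) / L\<^sup>2) powr (p / (p - 1)))"
proof -
  \<comment> \<open>With \<open>k > 2\<close>, \<open>\<eta>\<close> and \<open>\<eta>'\<close> vanish at the right endpoint and \<open>d\<close> is positive.\<close>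
  have "2 < 2 * p / (p - 1)" using p by (simp add: field_simps)
  then have k2: "2 < k" using k by linarith
  obtain j where j: "k = Suc (Suc j)" using k2 by (metis add_2_eq_Suc less_imp_add_positive plus_nat.simps(2))
  define d where "d = m * k / L + k * (real k - 1) / L\<^sup>2"
  have d: "0 < d" unfolding d_def using k2 m L by (intro add_nonneg_pos) auto
  define B where "B = \<kappa> powr (- 1 / (p - 1)) * d powr (p / (p - 1))"
  define \<sigma> where "\<sigma> s = 1 - (s - a) / L" for s
  define \<eta> where "\<eta> s = \<sigma> s ^ k" for s
  define \<eta>' where "\<eta>' s = - (k / L) * \<sigma> s ^ (k - 1)" for s
  define \<eta>'' where "\<eta>'' s = k * (real k - 1) / L\<^sup>2 * \<sigma> s ^ (k - 2)" for s
  have d\<sigma>: "(\<sigma> has_real_derivative - 1 / L) (at s within X)" for s X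
    unfolding \<sigma>_def using L by (auto intro!: derivative_eq_intros)
  have d\<eta>: "(\<eta> has_real_derivative \<eta>' s) (at s within X)" for s X
    unfolding \<eta>_def[abs_def] \<eta>'_def
    by (rule DERIV_cong[OF DERIV_power[OF d\<sigma>]]) (simp add: j)
  have d\<eta>': "(\<eta>' has_real_derivative \<eta>'' s) (at s within X)" for s X
    unfolding \<eta>'_def[abs_def] \<eta>''_def
    by (rule DERIV_cong[OF DERIV_cmult[OF DERIV_power[OF d\<sigma>]]])
      (use L in \<open>simp add: j power2_eq_square field_simps\<close>)
  define N where "N s = G' s * \<eta> s + m * (G s * \<eta> s) - G s * \<eta>' s" for s
  define N' where "N' s = (G'' s + m * G' s) * \<eta> s + G s * (m * \<eta>' s - \<eta>'' s)" for s
  have dN: "(N has_real_derivative N' s) (at s within {a..a + L})" if "s \<in> {a..a + L}" for s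
    unfolding N_def[abs_def] N'_def
    by (rule derivative_eq_intros G[OF that] G'[OF that] d\<eta> d\<eta>' refl)+ (simp add: algebra_simps)
  have N'_ge: "- B \<le> N' s" if s: "a < s" "s < a + L" for s
  proof -
    have \<sigma>: "0 < \<sigma> s" "\<sigma> s < 1" using s L by (auto simp: \<sigma>_def field_simps)
    have Gs: "0 \<le> G s" using pos s by simp
    have "m * (k / L) * \<sigma> s ^ (k - 1) \<le> m * (k / L) * \<sigma> s ^ (k - 2)"
      using \<sigma> m L by (intro mult_left_mono power_decreasing) auto
    then have "\<eta>'' s - m * \<eta>' s \<le> d * \<sigma> s ^ (k - 2)"
      by (simp add: \<eta>''_def \<eta>'_def d_def algebra_simps)
    then have 1: "G s * (\<eta>'' s - m * \<eta>' s) \<le> G s * (d * \<sigma> s ^ (k - 2))"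
      using Gs by (rule mult_left_mono)
    have 2: "\<kappa> * G s powr p * \<eta> s \<le> (G'' s + m * G' s) * \<eta> s"
      using ineq[OF s] \<sigma> by (intro mult_right_mono) (auto simp: \<eta>_def)
    have "G s * (d * \<sigma> s ^ (k - 2)) - (\<kappa> * \<eta> s) * G s powr p
        \<le> (\<kappa> * \<eta> s) powr (- 1 / (p - 1)) * (d * \<sigma> s ^ (k - 2)) powr (p / (p - 1))"
      using p Gs d \<sigma> \<kappa> by (intro linear_minus_power_le) (auto simp: \<eta>_def)
    also have "\<dots> = B * (\<sigma> s powr (k * (- 1 / (p - 1))) * \<sigma> s powr (real (k - 2) * (p / (p - 1))))"
      using d \<sigma> \<kappa> by (simp add: B_def \<eta>_def powr_mult powr_realpow[symmetric] powr_powr)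
    also have "\<sigma> s powr (k * (- 1 / (p - 1))) * \<sigma> s powr (real (k - 2) * (p / (p - 1)))
        = \<sigma> s powr (k - 2 * p / (p - 1))"
      proof -
      have "k * (- 1 / r) + real (k - 2) * ((r + 1) / r) = k - 2 * (r + 1) / r"
        if "0 < r" for r :: real
        using that k2 by (simp add: of_nat_diff field_simps)
      from this[of "p - 1"] show ?thesis unfolding powr_add[symmetric] using p by simp
    qed
    also have "\<dots> \<le> 1" using \<sigma> k by (intro powr_le1) auto
    finally have "G s * (d * \<sigma> s ^ (k - 2)) - (\<kappa> * \<eta> s) * G s powr p \<le> B"
      using d \<kappa> by (simp add: B_def mult_left_le)
    then show ?thesis using 1 2 by (simp add: N'_def algebra_simps)
  qed
  have "\<exists>s. a < s \<and> s < a + L \<and> N (a + L) - N a = (a + L - a) * N' s"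
  proof (rule mean_value_within)
    show "a < a + L" using L by simp
    show "(N has_real_derivative N' s) (at s within {a..a+L})" if "s \<in> {a..a+L}" for s by (rule dN[OF that])
  qed
  then obtain s where s: "a < s" "s < a + L" "N (a + L) - N a = L * N' s" by auto
  have "N (a + L) = 0" using L by (simp add: N_def \<eta>_def \<eta>'_def \<sigma>_def j)
  moreover have "N a = G' a + (m + k / L) * G a"
    by (simp add: N_def \<eta>_def \<eta>'_def \<sigma>_def algebra_simps)
  moreover have "L * (- B) \<le> L * N' s" using N'_ge[OF s(1,2)] L by (intro mult_left_mono) auto
  ultimately have "G' a + (m + k / L) * G a \<le> L * B" using s(3) by linarith
  then show ?thesis using k2 by (simp add: B_def d_def of_nat_diff)
qed

text \<open>
The nonlinear term has \<open>\<bar>F t\<bar>\<close>, because the inequality is derived for the spatial integral of a solution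
before its sign is known; \<open>F \<ge> 0\<close> is then a consequence (lemma \<open>fujita_ode_monotone\<close>).
\<close>
definition fujita_ode where
  "fujita_ode \<mu> c q p A B S F F' F'' \<longleftrightarrow>
    (\<forall>t\<in>{1..S}. (F has_real_derivative F' t) (at t within {1..S})) \<and>
    (\<forall>t\<in>{1..S}. (F' has_real_derivative F'' t) (at t within {1..S})) \<and>
    F 1 = A \<and> F' 1 = B \<and>
    (\<forall>t. 1 < t \<and> t < S \<longrightarrow> c * t powr (- q) * \<bar>F t\<bar> powr p \<le> F'' t + \<mu> / t * F' t)"

text \<open>
The inequality says in particular that \<open>t powr \<mu> * F' t\<close> has a nonnegative derivative.
\<close>
lemma fujita_ode_monotone:
  assumes ode: "fujita_ode \<mu> c q p A B S F F' F''" and "0 \<le> c" "0 \<le> A" "0 \<le> B" and t: "t \<in> {1..S}"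
  shows "0 \<le> F' t" and "A \<le> F t"
proof -
  have dF: "\<And>t. t \<in> {1..S} \<Longrightarrow> (F has_real_derivative F' t) (at t within {1..S})"
    and dF': "\<And>t. t \<in> {1..S} \<Longrightarrow> (F' has_real_derivative F'' t) (at t within {1..S})"
    and init: "F 1 = A" "F' 1 = B"
    and ineq: "\<And>t. 1 < t \<Longrightarrow> t < S \<Longrightarrow> c * t powr (- q) * \<bar>F t\<bar> powr p \<le> F'' t + \<mu> / t * F' t"
    using ode by (auto simp: fujita_ode_def)
  have F'_nonneg: "0 \<le> F' t" if t: "t \<in> {1..S}" for t
  proof (cases "t = 1")
    case False
    have sub: "{1..t} \<subseteq> {1..S}" using t by auto
    \<comment> \<open>The integrating factor \<open>t powr \<mu>\<close> turns the left-hand side into a total derivative.\<close>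
    have "\<exists>s. 1 < s \<and> s < t \<and> t powr \<mu> * F' t - 1 powr \<mu> * F' 1
        = (t - 1) * (s powr \<mu> * (F'' s + \<mu> / s * F' s))"
    proof (rule mean_value_within)
      show "1 < t" using t False by simp
      fix s assume s: "s \<in> {1..t}"
      have "(F' has_real_derivative F'' s) (at s within {1..t})"
        using has_field_derivative_subset[OF dF' sub] s sub by blast
      then show "((\<lambda>t. t powr \<mu> * F' t) has_real_derivative s powr \<mu> * (F'' s + \<mu> / s * F' s)) (at s within {1..t})"
        using s by (auto intro!: derivative_eq_intros simp: powr_diff field_simps)
    qed
    then obtain s where s: "1 < s" "s < t" "t powr \<mu> * F' t - B = (t - 1) * (s powr \<mu> * (F'' s + \<mu> / s * F' s))"
      using init by auto
    have "0 \<le> F'' s + \<mu> / s * F' s"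
      using ineq[of s] s t \<open>0 \<le> c\<close> by (intro order.trans[OF _ ineq]) auto
    then have "0 \<le> t powr \<mu> * F' t - B" unfolding s(3) using s by simp
    then have "0 \<le> t powr \<mu> * F' t" using \<open>0 \<le> B\<close> by simp
    moreover have "0 < t powr \<mu>" using t by simp
    ultimately show ?thesis by (simp add: zero_le_mult_iff)
  qed (use init \<open>0 \<le> B\<close> in simp)
  show "0 \<le> F' t" by (rule F'_nonneg[OF t])
  show "A \<le> F t"
  proof (cases "t = 1")
    case False
    have sub: "{1..t} \<subseteq> {1..S}" using t by auto
    have "\<exists>s. 1 < s \<and> s < t \<and> F t - F 1 = (t - 1) * F' s"
      using t False sub by (intro mean_value_within) (auto intro: has_field_derivative_subset[OF dF])
    then obtain s where s: "1 < s" "s < t" "F t - A = (t - 1) * F' s" using init by auto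
    have "0 \<le> (t - 1) * F' s" using s t F'_nonneg[of s] by simp
    then show ?thesis using s(3) by linarith
  qed (use init in simp)
qed

text \<open>
In the variable \<open>s = ln t\<close> the damping coefficient becomes constant:
\<open>G s = F (exp s)\<close> satisfies \<open>G'' + (\<mu> - 1) * G' = t\<^sup>2 * (F'' + \<mu> / t * F')\<close>. Since \<open>G' \<ge> 0\<close>, the coefficient
\<open>\<mu> - 1\<close> may be enlarged to \<open>m\<close>, and since \<open>q \<le> 2\<close>, the growing factor
\<open>exp ((2 - q) * s)\<close> may be replaced by its value at the left endpoint.
\<close>
lemma fujita_ode_log_bound:
  fixes k :: nat and \<mu> c q p m L a :: real
  assumes ode: "fujita_ode \<mu> c q p A B S F F' F''" and c: "0 < c" and A: "0 \<le> A" and B: "0 \<le> B"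
    and p: "1 < p" and q: "q \<le> 2" and m: "0 \<le> m" "\<mu> - 1 \<le> m" and L: "0 < L" and a: "0 \<le> a"
    and aL: "exp (a + L) = S" and k: "2 * p / (p - 1) \<le> real k"
  shows "exp a * F' (exp a) + (m + k / L) * F (exp a)
    \<le> L * ((c * exp ((2 - q) * a)) powr (- 1 / (p - 1)) * (m * k / L + real k * (real k - 1) / L\<^sup>2) powr (p / (p - 1)))"
proof -
  have dF: "\<And>t. t \<in> {1..S} \<Longrightarrow> (F has_real_derivative F' t) (at t within {1..S})"
    and dF': "\<And>t. t \<in> {1..S} \<Longrightarrow> (F' has_real_derivative F'' t) (at t within {1..S})"
    and ineq: "\<And>t. 1 < t \<Longrightarrow> t < S \<Longrightarrow> c * t powr (- q) * \<bar>F t\<bar> powr p \<le> F'' t + \<mu> / t * F' t"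
    using ode by (auto simp: fujita_ode_def)
  note mono = fujita_ode_monotone[OF ode less_imp_le[OF c] A B]
  have img: "exp s \<in> {1..S}" if "s \<in> {a..a + L}" for s
    using that a aL by (auto simp flip: aL)
  have comp: "((\<lambda>s. f (exp s)) has_real_derivative f' (exp s) * exp s) (at s within {a..a + L})"
    if "\<And>t. t \<in> {1..S} \<Longrightarrow> (f has_real_derivative f' t) (at t within {1..S})" "s \<in> {a..a + L}" for f f' s
  proof (rule DERIV_image_chain[where g=exp, unfolded o_def])
    show "(f has_real_derivative f' (exp s)) (at (exp s) within exp ` {a..a + L})"
      using img that(2) by (intro has_field_derivative_subset[OF that(1)]) auto
  qed (auto intro!: derivative_eq_intros)
  define G where "G s = F (exp s)" for s
  define G' where "G' s = F' (exp s) * exp s" for s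
  define G'' where "G'' s = F'' (exp s) * exp s * exp s + F' (exp s) * exp s" for s
  have "G' a + (m + k / L) * G a
    \<le> L * ((c * exp ((2 - q) * a)) powr (- 1 / (p - 1)) * (m * k / L + real k * (real k - 1) / L\<^sup>2) powr (p / (p - 1)))"
  proof (rule convex_ode_inequality_bound[where G=G and G'=G' and G''=G'', OF p _ m(1) L k])
    show "0 < c * exp ((2 - q) * a)" using c by simp
    fix s assume s: "s \<in> {a..a + L}"
    show "(G has_real_derivative G' s) (at s within {a..a + L})"
      unfolding G_def[abs_def] G'_def by (rule comp[OF dF s])
    show "(G' has_real_derivative G'' s) (at s within {a..a + L})"
      unfolding G'_def[abs_def] G''_def by (auto intro!: derivative_eq_intros comp[OF dF' s])
    show "0 \<le> G s" using mono(2)[OF img[OF s]] A by (simp add: G_def)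
  next
    fix s assume s: "a < s" "s < a + L"
    define t where "t = exp s"
    have t: "1 < t" "t < S" using s a aL by (auto simp: t_def simp flip: aL)
    have F': "0 \<le> F' t" using t by (intro mono) auto
    have F: "0 \<le> F t" using mono(2)[of t] A t by auto
    have "c * exp ((2 - q) * a) * G s powr p \<le> c * exp ((2 - q) * s) * G s powr p"
      using c q s by (intro mult_right_mono mult_left_mono) (auto intro!: mult_left_mono)
    also have "exp ((2 - q) * s) = t powr (- q) * t\<^sup>2"
      by (simp add: t_def powr_def power2_eq_square algebra_simps flip: exp_add)
    also have "c * (t powr (- q) * t\<^sup>2) * G s powr p = t\<^sup>2 * (c * t powr (- q) * \<bar>F t\<bar> powr p)"
      using F by (simp add: G_def t_def)
    also have "\<dots> \<le> t\<^sup>2 * (F'' t + \<mu> / t * F' t)"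
      using ineq[OF t] by (intro mult_left_mono) auto
    also have "\<dots> = G'' s + (\<mu> - 1) * G' s"
      using t by (simp add: G''_def G'_def t_def[symmetric] power2_eq_square algebra_simps)
    also have "\<dots> \<le> G'' s + m * G' s"
      using m F' t by (intro add_left_mono mult_right_mono) (auto simp: G'_def t_def)
    finally show "c * exp ((2 - q) * a) * G s powr p \<le> G'' s + m * G' s" .
  qed
  then show ?thesis by (simp add: G_def G'_def mult.commute)
qed

lemma le_of_powr_le:
  fixes x K \<epsilon> \<beta> :: real
  assumes "x powr \<beta> \<le> K / \<epsilon>" "0 < x" "0 < K" "0 < \<epsilon>" "0 < \<beta>"
  shows "x \<le> K powr (1 / \<beta>) * \<epsilon> powr (- (1 / \<beta>))"
proof -
  have "(x powr \<beta>) powr (1 / \<beta>) \<le> (K / \<epsilon>) powr (1 / \<beta>)"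
    using assms by (intro powr_mono2) auto
  also have "\<dots> = K powr (1 / \<beta>) * \<epsilon> powr (- (1 / \<beta>))"
    using assms by (simp add: powr_divide powr_minus field_simps)
  finally show ?thesis using assms by (simp add: powr_powr)
qed

lemma cutoff_exponent:
  fixes p :: real
  assumes "1 < p"
  obtains k :: nat where "2 * p / (p - 1) \<le> real k" "2 < k"
proof -
  obtain k :: nat where k: "2 * p / (p - 1) \<le> real k" using real_arch_simple by blast
  have "2 < 2 * p / (p - 1)" using assms by (simp add: field_simps)
  then show thesis using k that[of k] by linarith
qed

text \<open>
The test interval is \<open>{ln S - 1..ln S}\<close>. There \<open>F \<ge> \<epsilon> * A\<close>, while the bound of
\<open>fujita_ode_log_bound\<close> is proportional to \<open>S powr (- (2 - q) / (p - 1))\<close>.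
\<close>
lemma fujita_ode_subcritical:
  fixes \<mu> c q p A B :: real
  assumes c: "0 < c" and A: "0 < A" and B: "0 < B" and p: "1 < p" and q: "q < 2"
  obtains C where "0 < C" "\<And>\<epsilon> S F F' F''. 0 < \<epsilon> \<Longrightarrow> 1 < S \<Longrightarrow>
    fujita_ode \<mu> c q p (\<epsilon> * A) (\<epsilon> * B) S F F' F'' \<Longrightarrow> S \<le> exp 1 + C * \<epsilon> powr (- ((p - 1) / (2 - q)))"
proof -
  obtain k :: nat where k: "2 * p / (p - 1) \<le> real k" "2 < k" using cutoff_exponent[OF p] .
  define m where "m = max 0 (\<mu> - 1)"
  define K where "K = c powr (- 1 / (p - 1)) * (m * k + real k * (real k - 1)) powr (p / (p - 1)) / A"
  define C where "C = exp 1 * K powr (1 / ((2 - q) / (p - 1)))"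
  have d: "0 < m * k + real k * (real k - 1)" using k by (intro add_nonneg_pos) (auto simp: m_def)
  then have K: "0 < K" using c A by (simp add: K_def)
  then have C: "0 < C" by (simp add: C_def)
  have "S \<le> exp 1 + C * \<epsilon> powr (- ((p - 1) / (2 - q)))"
    if \<epsilon>: "0 < \<epsilon>" and S: "1 < S" and ode: "fujita_ode \<mu> c q p (\<epsilon> * A) (\<epsilon> * B) S F F' F''" for \<epsilon> S F F' F''
  proof (cases "exp 1 \<le> S")
    case True
    define a where "a = ln S - 1"
    have a: "0 \<le> a" using True S by (simp add: a_def ln_ge_iff)
    have aL: "exp (a + 1) = S" using S by (simp add: a_def)
    have ea: "exp a = S / exp 1" using S by (simp add: a_def exp_diff)
    have "exp a \<in> {1..S}" using a aL by (auto simp flip: aL)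
    note mono = fujita_ode_monotone[OF ode less_imp_le[OF c] _ _ this]
    have pos: "0 \<le> \<epsilon> * A" "0 \<le> \<epsilon> * B" using \<epsilon> A B by auto
    have "\<epsilon> * A \<le> F (exp a)" by (rule mono(2)[OF pos])
    also have "\<dots> \<le> (m + k / 1) * F (exp a)"
    proof -
      have "1 \<le> m + k / 1" using k by (simp add: m_def)
      moreover have "0 \<le> F (exp a)" using mono(2)[OF pos] pos by linarith
      ultimately show ?thesis using mult_right_mono[of 1 "m + k / 1" "F (exp a)"] by simp
    qed
    also have "\<dots> \<le> exp a * F' (exp a) + (m + k / 1) * F (exp a)"
      using mono(1)[OF pos] by simp
    also have "\<dots> \<le> 1 * ((c * exp ((2 - q) * a)) powr (- 1 / (p - 1))
        * (m * k / 1 + real k * (real k - 1) / 1\<^sup>2) powr (p / (p - 1)))"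
      using q by (intro fujita_ode_log_bound[where m=m and L=1 and a=a and \<mu>=\<mu> and q=q, OF ode c pos p _ _ _ _ a aL k(1)]) (auto simp: m_def)
    also have "\<dots> = A * K * exp ((2 - q) * a) powr (- 1 / (p - 1))"
      using c A by (simp add: K_def powr_mult)
    also have "exp ((2 - q) * a) powr (- 1 / (p - 1)) = inverse (exp a powr ((2 - q) / (p - 1)))"
      by (simp add: powr_def flip: exp_minus)
    finally have "\<epsilon> \<le> K * inverse (exp a powr ((2 - q) / (p - 1)))" using A by simp
    then have "exp a powr ((2 - q) / (p - 1)) \<le> K / \<epsilon>" using \<epsilon> by (simp add: field_simps)
    then have "exp a \<le> K powr (1 / ((2 - q) / (p - 1))) * \<epsilon> powr (- (1 / ((2 - q) / (p - 1))))"
      using K \<epsilon> p q by (intro le_of_powr_le) auto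
    then have "S \<le> C * \<epsilon> powr (- ((p - 1) / (2 - q)))"
      by (simp add: ea C_def field_simps)
    then show ?thesis using exp_gt_zero[of "1::real"] by linarith
  next
    case False
    then show ?thesis using C by (intro add_increasing2) auto
  qed
  then show thesis using that C by blast
qed

text \<open>
With the test interval \<open>{0..ln S}\<close> of length \<open>L \<ge> 1\<close>, the first-order damping dominates and the
bound is proportional to \<open>L * (1 / L) powr (p / (p - 1)) = L powr (- 1 / (p - 1))\<close>. It is compared with
\<open>m * G 0\<close>, where \<open>m = \<mu> - 1 > 0\<close> and \<open>G 0 = \<epsilon> * A\<close>.
\<close>
lemma fujita_ode_critical_overdamped:
  fixes \<mu> c p A B :: real
  assumes c: "0 < c" and A: "0 < A" and B: "0 < B" and p: "1 < p" and \<mu>: "1 < \<mu>"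
  obtains C where "0 < C" "\<And>\<epsilon> S F F' F''. 0 < \<epsilon> \<Longrightarrow> 1 < S \<Longrightarrow>
    fujita_ode \<mu> c 2 p (\<epsilon> * A) (\<epsilon> * B) S F F' F'' \<Longrightarrow> ln S \<le> 1 + C * \<epsilon> powr (- (p - 1))"
proof -
  obtain k :: nat where k: "2 * p / (p - 1) \<le> real k" "2 < k" using cutoff_exponent[OF p] .
  define m where "m = \<mu> - 1"
  have m: "0 < m" using \<mu> by (simp add: m_def)
  define d where "d = m * k + k * (real k - 1)"
  have d: "0 < d" unfolding d_def using k m by (intro add_pos_pos) auto
  define K where "K = c powr (- 1 / (p - 1)) * d powr (p / (p - 1)) / (m * A)"
  define C where "C = K powr (1 / (1 / (p - 1)))"
  have K: "0 < K" using c A m d by (simp add: K_def)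
  then have C: "0 < C" by (simp add: C_def)
  have "ln S \<le> 1 + C * \<epsilon> powr (- (p - 1))"
    if \<epsilon>: "0 < \<epsilon>" and S: "1 < S" and ode: "fujita_ode \<mu> c 2 p (\<epsilon> * A) (\<epsilon> * B) S F F' F''" for \<epsilon> S F F' F''
  proof (cases "1 \<le> ln S")
    case True
    define L where "L = ln S"
    have L: "1 \<le> L" using True by (simp add: L_def)
    have aL: "exp (0 + L) = S" using S by (simp add: L_def)
    have init: "F 1 = \<epsilon> * A" "F' 1 = \<epsilon> * B" using ode by (auto simp: fujita_ode_def)
    have pos: "0 \<le> \<epsilon> * A" "0 \<le> \<epsilon> * B" using \<epsilon> A B by auto
    have "m * (\<epsilon> * A) \<le> exp 0 * F' (exp 0) + (m + k / L) * F (exp 0)"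
    proof -
      have "0 \<le> k / L * (\<epsilon> * A)" using \<epsilon> A L by simp
      then show ?thesis using init pos by (simp add: distrib_right)
    qed
    also have "\<dots> \<le> L * ((c * exp ((2 - 2) * 0)) powr (- 1 / (p - 1))
        * (m * k / L + real k * (real k - 1) / L\<^sup>2) powr (p / (p - 1)))"
      using m L by (intro fujita_ode_log_bound[OF ode c pos p _ _ _ _ _ aL k(1)]) (auto simp: m_def)
    also have "\<dots> \<le> L * (c powr (- 1 / (p - 1)) * (d / L) powr (p / (p - 1)))"
    proof -
      \<comment> \<open>For \<open>L \<ge> 1\<close> the first-order term \<open>1 / L\<close> dominates \<open>1 / L\<^sup>2\<close>.\<close>
      have "k * (real k - 1) / L\<^sup>2 \<le> k * (real k - 1) / L"
        using L k by (intro divide_left_mono) (auto simp: power2_eq_square)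
      then have "m * k / L + k * (real k - 1) / L\<^sup>2 \<le> d / L"
        by (simp add: d_def add_divide_distrib)
      moreover have "0 \<le> m * k / L + k * (real k - 1) / L\<^sup>2" using m k L by auto
      ultimately have "(m * k / L + k * (real k - 1) / L\<^sup>2) powr (p / (p - 1)) \<le> (d / L) powr (p / (p - 1))"
        using p by (intro powr_mono2) auto
      then show ?thesis using L by (simp add: mult_left_mono)
    qed
    also have "\<dots> = m * A * K * (L powr 1 * L powr (- (p / (p - 1))))"
      using d L m A by (simp add: K_def powr_divide powr_minus field_simps)
    also have "L powr 1 * L powr (- (p / (p - 1))) = L powr (- (1 / (p - 1)))"
      unfolding powr_add[symmetric] using p by (simp add: field_simps)
    finally have "\<epsilon> \<le> K * L powr (- (1 / (p - 1)))" using A m by (simp add: field_simps)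
    then have "L powr (1 / (p - 1)) \<le> K / \<epsilon>" using \<epsilon> L by (simp add: powr_minus field_simps)
    then have "L \<le> K powr (1 / (1 / (p - 1))) * \<epsilon> powr (- (1 / (1 / (p - 1))))"
      using K \<epsilon> p L by (intro le_of_powr_le) auto
    then show ?thesis by (simp add: L_def C_def)
  next
    case False
    then show ?thesis using C by (intro add_increasing2) auto
  qed
  then show thesis using that C by blast
qed

text \<open>
Here \<open>m = 0\<close> is admissible, so that on \<open>{0..L}\<close> with \<open>L = ln S\<close> only the second derivative of the
cut-off remains and the bound is proportional to
\<open>L * (1 / L\<^sup>2) powr (p / (p - 1)) = L powr (- (p + 1) / (p - 1))\<close>. It is compared with \<open>G' 0 = \<epsilon> * B\<close>.
\<close>
lemma fujita_ode_critical_underdamped: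
  fixes \<mu> c p A B :: real
  assumes c: "0 < c" and A: "0 < A" and B: "0 < B" and p: "1 < p" and \<mu>: "\<mu> \<le> 1"
  obtains C where "0 < C" "\<And>\<epsilon> S F F' F''. 0 < \<epsilon> \<Longrightarrow> 1 < S \<Longrightarrow>
    fujita_ode \<mu> c 2 p (\<epsilon> * A) (\<epsilon> * B) S F F' F'' \<Longrightarrow> ln S \<le> C * \<epsilon> powr (- ((p - 1) / (p + 1)))"
proof -
  obtain k :: nat where k: "2 * p / (p - 1) \<le> real k" "2 < k" using cutoff_exponent[OF p] .
  define d where "d = k * (real k - 1)"
  have d: "0 < d" unfolding d_def using k by auto
  define K where "K = c powr (- 1 / (p - 1)) * d powr (p / (p - 1)) / B"
  define C where "C = K powr (1 / ((p + 1) / (p - 1)))"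
  have K: "0 < K" using c B d by (simp add: K_def)
  then have C: "0 < C" by (simp add: C_def)
  have "ln S \<le> C * \<epsilon> powr (- ((p - 1) / (p + 1)))"
    if \<epsilon>: "0 < \<epsilon>" and S: "1 < S" and ode: "fujita_ode \<mu> c 2 p (\<epsilon> * A) (\<epsilon> * B) S F F' F''" for \<epsilon> S F F' F''
  proof -
    define L where "L = ln S"
    have L: "0 < L" using S by (simp add: L_def)
    have aL: "exp (0 + L) = S" using S by (simp add: L_def)
    have init: "F 1 = \<epsilon> * A" "F' 1 = \<epsilon> * B" using ode by (auto simp: fujita_ode_def)
    have pos: "0 \<le> \<epsilon> * A" "0 \<le> \<epsilon> * B" using \<epsilon> A B by auto
    have "\<epsilon> * B \<le> exp 0 * F' (exp 0) + (0 + k / L) * F (exp 0)"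
      using init pos L k by simp
    also have "\<dots> \<le> L * ((c * exp ((2 - 2) * 0)) powr (- 1 / (p - 1))
        * ((0::real) * k / L + real k * (real k - 1) / L\<^sup>2) powr (p / (p - 1)))"
      using \<mu> L by (intro fujita_ode_log_bound[where m=0 and L=L and a=0 and \<mu>=\<mu> and q=2, OF ode c pos p _ _ _ _ _ aL k(1)]) auto
    also have "\<dots> = B * K * (L powr 1 * (L\<^sup>2) powr (- (p / (p - 1))))"
      using d L B k by (simp add: K_def d_def powr_divide powr_minus of_nat_diff field_simps)
    also have "(L\<^sup>2) powr (- (p / (p - 1))) = L powr (- (2 * p / (p - 1)))"
      using L powr_powr[of L 2 "- (p / (p - 1))"] by (simp add: powr_numeral)
    also have "L powr 1 * L powr (- (2 * p / (p - 1))) = L powr (- ((p + 1) / (p - 1)))"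
    proof -
      have "1 + - (2 * p / (p - 1)) = - ((p + 1) / (p - 1))" using p by (simp add: field_simps)
      then show ?thesis unfolding powr_add[symmetric] by simp
    qed
    finally have "\<epsilon> \<le> K * L powr (- ((p + 1) / (p - 1)))" using B by (simp add: field_simps)
    then have "L powr ((p + 1) / (p - 1)) \<le> K / \<epsilon>" using \<epsilon> L by (simp add: powr_minus field_simps)
    then have "L \<le> K powr (1 / ((p + 1) / (p - 1))) * \<epsilon> powr (- (1 / ((p + 1) / (p - 1))))"
      using K \<epsilon> p L by (intro le_of_powr_le) auto
    then show ?thesis by (simp add: L_def C_def)
  qed
  then show thesis using that C by blast
qed

section \<open>Finite speed of propagation\<close>

lemma gronwall_vanishing:
  fixes E E' :: "real \<Rightarrow> real"
  assumes "a < b" and dE: "\<And>t. t \<in> {a..b} \<Longrightarrow> (E has_real_derivative E' t) (at t within {a..b})"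
    and le: "\<And>t. a < t \<Longrightarrow> t < b \<Longrightarrow> E' t \<le> C * E t" and "E a = 0" and "0 \<le> E b"
  shows "E b = 0"
proof -
  have "\<exists>s. a < s \<and> s < b \<and> exp (- C * b) * E b - exp (- C * a) * E a
      = (b - a) * (exp (- C * s) * (E' s - C * E s))"
    using assms(1)
    by (intro mean_value_within) (auto intro!: derivative_eq_intros dE simp: algebra_simps)
  then obtain s where s: "a < s" "s < b"
      "exp (- C * b) * E b = (b - a) * (exp (- C * s) * (E' s - C * E s))"
    using \<open>E a = 0\<close> by auto
  have "(b - a) * (exp (- C * s) * (E' s - C * E s)) \<le> 0"
    using le[OF s(1,2)] \<open>a < b\<close> by (intro mult_nonneg_nonpos) auto
  then have "exp (- C * b) * E b \<le> 0" using s(3) by simp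
  then have "E b \<le> 0" by (simp only: mult_le_0_iff) (metis exp_gt_zero not_le)
  then show ?thesis using \<open>0 \<le> E b\<close> by simp
qed

definition sound_speed :: "real \<Rightarrow> real \<Rightarrow> real" where
  "sound_speed \<alpha> t = t powr (- \<alpha>)"

text \<open>
The integral of the sound speed from \<open>1\<close> to \<open>t\<close>: the distance a wave front travels in that time.
\<close>
definition sound_distance :: "real \<Rightarrow> real \<Rightarrow> real" where
  "sound_distance \<alpha> t = (t powr (1 - \<alpha>) - 1) / (1 - \<alpha>)"

lemma DERIV_sound_distance:
  assumes "\<alpha> < 1" "0 < t"
  shows "(sound_distance \<alpha> has_real_derivative sound_speed \<alpha> t) (at t within X)"
  unfolding sound_distance_def[abs_def] sound_speed_def
  using assms by (auto intro!: derivative_eq_intros)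

lemma sound_distance_mono:
  assumes "\<alpha> < 1" "0 \<le> s" "s \<le> t" shows "sound_distance \<alpha> s \<le> sound_distance \<alpha> t"
  unfolding sound_distance_def using assms by (intro divide_right_mono diff_right_mono powr_mono2) auto

lemma sound_distance_1 [simp]: "sound_distance \<alpha> 1 = 0"
  by (simp add: sound_distance_def)

text \<open>
The pointwise core of the energy method, at one point of space-time: \<open>v\<close>, \<open>grad\<close> and \<open>z\<close> stand for
the time derivative, the spatial gradient and the value of the solution, \<open>f\<close> for the nonlinearity,
\<open>W\<^sup>2\<close> for the weight and \<open>d\<close> for \<open>x - y\<close>. The weight decreases in time at a rate that is at
least the sound speed times its spatial slope, so the first line pays for the flux term in the third.
The remaining terms have a favourable sign or are bounded by the energy density itself.
\<close>
lemma energy_flux_estimate: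
  fixes d grad :: "'a::real_inner" and v z c c' t W \<rho> K f \<mu> :: real
  assumes c: "0 \<le> c" and c': "c' \<le> 0" and W: "0 \<le> W" and \<rho>: "0 \<le> \<rho>" and \<mu>: "0 \<le> \<mu>" and t: "0 < t"
    and K: "0 \<le> K" and f: "0 < W \<Longrightarrow> \<bar>f\<bar> \<le> K * \<bar>z\<bar>" and d: "0 < W \<Longrightarrow> norm d \<le> \<rho>"
  shows "- 4 * W * \<rho> * c * (v\<^sup>2 + c\<^sup>2 * (norm grad)\<^sup>2 + z\<^sup>2)
      + W\<^sup>2 * (2 * v * (f - \<mu> / t * v) + 2 * c * c' * (norm grad)\<^sup>2 + 2 * z * v)
      + 8 * c\<^sup>2 * v * W * (d \<bullet> grad)
    \<le> (K + 1) * (W\<^sup>2 * (v\<^sup>2 + c\<^sup>2 * (norm grad)\<^sup>2 + z\<^sup>2))"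
proof (cases "W = 0")
  case False
  then have W: "0 < W" using W by simp
  let ?g = "norm grad"
  have sq: "2 * (\<bar>a\<bar> * \<bar>b\<bar>) \<le> a\<^sup>2 + b\<^sup>2" for a b :: real
    using sum_squares_bound[of "\<bar>a\<bar>" "\<bar>b\<bar>"] by simp
  have "v * (d \<bullet> grad) \<le> \<bar>v\<bar> * \<bar>d \<bullet> grad\<bar>"
    using abs_ge_self[of "v * (d \<bullet> grad)"] by (simp add: abs_mult)
  also have "\<dots> \<le> \<bar>v\<bar> * (\<rho> * ?g)"
    using order.trans[OF Cauchy_Schwarz_ineq2[of d grad] mult_right_mono[OF d[OF W] norm_ge_zero]]
    by (intro mult_left_mono) auto
  finally have "8 * c\<^sup>2 * W * (v * (d \<bullet> grad)) \<le> 8 * c\<^sup>2 * W * (\<bar>v\<bar> * (\<rho> * ?g))"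
    using W by (intro mult_left_mono) auto
  also have "\<dots> = 4 * W * \<rho> * c * (2 * (\<bar>v\<bar> * \<bar>c * ?g\<bar>))"
    using c by (simp add: power2_eq_square abs_mult)
  also have "\<dots> \<le> 4 * W * \<rho> * c * (v\<^sup>2 + (c * ?g)\<^sup>2)"
    using sq[of v "c * ?g"] W \<rho> c by (intro mult_left_mono) auto
  also have "\<dots> \<le> 4 * W * \<rho> * c * (v\<^sup>2 + c\<^sup>2 * ?g\<^sup>2 + z\<^sup>2)"
    using W \<rho> c by (intro mult_left_mono) (auto simp: power_mult_distrib)
  finally have flux: "8 * c\<^sup>2 * v * W * (d \<bullet> grad) \<le> 4 * W * \<rho> * c * (v\<^sup>2 + c\<^sup>2 * ?g\<^sup>2 + z\<^sup>2)"
    by (simp add: mult_ac)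
  have "v * f \<le> \<bar>v\<bar> * \<bar>f\<bar>" using abs_ge_self[of "v * f"] by (simp add: abs_mult)
  also have "\<dots> \<le> \<bar>v\<bar> * (K * \<bar>z\<bar>)" using f[OF W] by (intro mult_left_mono) auto
  finally have "2 * (v * f) \<le> K * (2 * (\<bar>v\<bar> * \<bar>z\<bar>))" by (simp add: mult_ac)
  also have "\<dots> \<le> K * (v\<^sup>2 + z\<^sup>2)" using sq K by (intro mult_left_mono) auto
  finally have 1: "2 * (v * f) \<le> K * (v\<^sup>2 + z\<^sup>2)" .
  have 2: "2 * (z * v) \<le> v\<^sup>2 + z\<^sup>2"
    using sq[of z v] abs_ge_self[of "z * v"] by (simp add: abs_mult)
  have 3: "0 \<le> \<mu> / t * v\<^sup>2" using \<mu> t by simp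
  have 4: "c * c' * ?g\<^sup>2 \<le> 0" using c c' by (intro mult_nonpos_nonneg mult_nonneg_nonpos) auto
  have 5: "0 \<le> (K + 1) * (c\<^sup>2 * ?g\<^sup>2)" using K by simp
  have "2 * v * (f - \<mu> / t * v) + 2 * c * c' * ?g\<^sup>2 + 2 * z * v
      = 2 * (v * f) - 2 * (\<mu> / t * v\<^sup>2) + 2 * (c * c' * ?g\<^sup>2) + 2 * (z * v)"
    by (simp add: algebra_simps power2_eq_square)
  also have "\<dots> \<le> K * (v\<^sup>2 + z\<^sup>2) + (v\<^sup>2 + z\<^sup>2) + (K + 1) * (c\<^sup>2 * ?g\<^sup>2)"
    using 1 2 3 4 5 by linarith
  also have "\<dots> = (K + 1) * (v\<^sup>2 + c\<^sup>2 * ?g\<^sup>2 + z\<^sup>2)" by (simp add: algebra_simps)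
  finally have "W\<^sup>2 * (2 * v * (f - \<mu> / t * v) + 2 * c * c' * ?g\<^sup>2 + 2 * z * v)
      \<le> W\<^sup>2 * ((K + 1) * (v\<^sup>2 + c\<^sup>2 * ?g\<^sup>2 + z\<^sup>2))"
    by (intro mult_left_mono) auto
  then show ?thesis using flux by (simp add: algebra_simps)
qed simp

context damped_wave
begin

lemma continuous_on_compact_time:
  assumes "continuous_on (time_interval T \<times> UNIV) (\<lambda>(t, x). f t x)" "\<tau> \<in> time_interval T"
  shows "continuous_on ({1..\<tau>} \<times> UNIV) (\<lambda>z. f (fst z) (snd z :: 'a))"
proof -
  have "{1..\<tau>} \<times> UNIV \<subseteq> time_interval T \<times> UNIV"
    using Icc_subset_time_interval[OF assms(2)] by auto
  from continuous_on_subset[OF assms(1) this] show ?thesis by (simp add: split_beta)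
qed

lemma continuous_on_slice:
  assumes "continuous_on (time_interval T \<times> UNIV) (\<lambda>(t, x). f t x)" "t \<in> time_interval T"
  shows "continuous_on UNIV (f t :: 'a \<Rightarrow> real)"
proof -
  have "continuous_on UNIV ((\<lambda>(t, x). f t x) \<circ> (\<lambda>x. (t, x)))"
    by (rule continuous_on_compose) (auto intro!: continuous_intros continuous_on_subset[OF assms(1)] simp: assms(2))
  then show ?thesis by (simp add: o_def)
qed

lemma DERIV_compact_time:
  assumes "\<And>t. t \<in> time_interval T \<Longrightarrow> (f has_real_derivative f' t) (at t within time_interval T)"
    and "\<tau> \<in> time_interval T" "t \<in> {1..\<tau>}"
  shows "(f has_real_derivative f' t) (at t within {1..\<tau>})"
  using assms Icc_subset_time_interval by (blast intro: has_field_derivative_subset)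

lemma initial_data_vanish:
  assumes supp: "\<And>x. R < norm x \<Longrightarrow> u0 x = 0 \<and> u1 x = 0" and x: "R < norm x"
  shows "u 1 x = 0" "ut 1 x = 0" "b \<in> Basis \<Longrightarrow> D b 1 x = 0"
proof -
  show "u 1 x = 0" "ut 1 x = 0" using supp[OF x] by (auto simp: init_u init_ut)
  assume b: "b \<in> Basis"
  have one: "1 \<in> time_interval T" using T by (simp add: time_interval_def one_ereal_def)
  have "open {s. R < norm (x + s *\<^sub>R b)}"
    by (intro open_Collect_less continuous_intros)
  moreover have "((\<lambda>_. 0) has_real_derivative 0) (at (0::real))" by simp
  ultimately have "((\<lambda>s. u 1 (x + s *\<^sub>R b)) has_real_derivative 0) (at 0)"
    using x supp by (elim has_field_derivative_transform_within_open) (auto simp: init_u)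
  then show "D b 1 x = 0" using u_x[OF b one] DERIV_unique by blast
qed

text \<open>
On a compact set the nonlinearity is bounded linearly, since \<open>p > 1\<close>; this is all the energy method needs.
\<close>
lemma nonlinearity_bound:
  assumes p: "1 < p" and \<tau>: "\<tau> \<in> time_interval T"
  obtains K where "0 \<le> K" "\<And>t x. t \<in> {1..\<tau>} \<Longrightarrow> x \<in> centred_box r \<Longrightarrow> \<bar>u t x\<bar> powr p \<le> K * \<bar>u t x\<bar>"
proof -
  have "compact ({1..\<tau>} \<times> centred_box r :: (real \<times> 'a) set)"
    unfolding centred_box_def by (intro compact_Times) auto
  moreover have "continuous_on ({1..\<tau>} \<times> centred_box r) (\<lambda>z. u (fst z) (snd z))"
    by (rule continuous_on_subset[OF continuous_on_compact_time[OF cont_u \<tau>]]) auto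
  ultimately have "bounded ((\<lambda>z. u (fst z) (snd z)) ` ({1..\<tau>} \<times> centred_box r))"
    using compact_continuous_image compact_imp_bounded by blast
  then obtain M where M: "\<And>t x. t \<in> {1..\<tau>} \<Longrightarrow> x \<in> centred_box r \<Longrightarrow> \<bar>u t x\<bar> \<le> M"
    unfolding bounded_iff by fastforce
  show thesis
  proof
    show "0 \<le> M powr (p - 1)" by simp
    fix t x assume "t \<in> {1..\<tau>}" "x \<in> (centred_box r :: 'a set)"
    then have "\<bar>u t x\<bar> powr (p - 1) \<le> M powr (p - 1)" using p M by (intro powr_mono2) auto
    then have "\<bar>u t x\<bar> powr (p - 1) * \<bar>u t x\<bar> \<le> M powr (p - 1) * \<bar>u t x\<bar>"
      by (rule mult_right_mono) simp
    moreover have "\<bar>u t x\<bar> powr (p - 1) * \<bar>u t x\<bar> = \<bar>u t x\<bar> powr p"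
      using powr_add[of "\<bar>u t x\<bar>" "p - 1" 1] by simp
    ultimately show "\<bar>u t x\<bar> powr p \<le> M powr (p - 1) * \<bar>u t x\<bar>" by simp
  qed
qed

text \<open>
For a point \<open>y\<close> outside the expected support at time \<open>\<tau>\<close>, consider the backward cone
\<open>\<bar>x - y\<bar> < \<rho> t\<close> whose radius shrinks at the sound speed down to \<open>\<rho> \<tau> = \<delta> > 0\<close>. The choice of \<open>\<delta>\<close>
puts the bottom of the cone, at time \<open>1\<close>, outside the support of the data. The weight \<open>W\<^sup>2\<close> lives on
this cone, so the weighted energy starts from zero and stays zero by Gronwall's inequality, and \<open>W \<tau> y\<close>
is positive.
\<close>
lemma finite_propagation_speed:
  assumes \<alpha>: "0 \<le> \<alpha>" "\<alpha> < 1" and \<mu>: "0 \<le> \<mu>" and p: "1 < p"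
    and supp: "\<And>x. R < norm x \<Longrightarrow> u0 x = 0 \<and> u1 x = 0"
    and \<tau>: "\<tau> \<in> time_interval T" and far: "R + sound_distance \<alpha> \<tau> < norm y"
  shows "u \<tau> y = 0"
proof (cases "\<tau> = 1")
  case True
  then show ?thesis using initial_data_vanish(1)[OF supp] far by simp
next
  case False
  then have \<tau>1: "1 < \<tau>" using \<tau> by (simp add: time_interval_def)
  define \<delta> where "\<delta> = norm y - R - sound_distance \<alpha> \<tau>"
  have \<delta>: "0 < \<delta>" using far by (simp add: \<delta>_def)
  define \<rho> where "\<rho> t = \<delta> + sound_distance \<alpha> \<tau> - sound_distance \<alpha> t" for t
  define c where "c t = sound_speed \<alpha> t" for t
  define c' where "c' t = - \<alpha> * t powr (- \<alpha> - 1)" for t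
  have d\<rho>: "(\<rho> has_real_derivative - c t) (at t within X)" if "0 < t" for t X
    unfolding \<rho>_def[abs_def] c_def by (auto intro!: derivative_eq_intros DERIV_sound_distance \<alpha> that)
  have dc: "(c has_real_derivative c' t) (at t within X)" if "0 < t" for t X
    unfolding c_def[abs_def] c'_def sound_speed_def using that by (auto intro!: derivative_eq_intros)
  have \<rho>_pos: "0 < \<rho> t" if "t \<in> {1..\<tau>}" for t
    using sound_distance_mono[OF \<alpha>(2), of t \<tau>] that \<delta> by (simp add: \<rho>_def)
  have \<rho>_le: "\<rho> t \<le> \<rho> 1" if "t \<in> {1..\<tau>}" for t
    using sound_distance_mono[OF \<alpha>(2), of 1 t] that by (simp add: \<rho>_def)
  have \<rho>1: "\<rho> 1 = norm y - R" by (simp add: \<rho>_def \<delta>_def)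
  define W where "W t x = max 0 ((\<rho> t)\<^sup>2 - (x - y) \<bullet> (x - y))" for t x
  have W_pos: "0 < W t x \<Longrightarrow> norm (x - y) < \<rho> t" if "t \<in> {1..\<tau>}" for t x
    using \<rho>_pos[OF that] by (auto simp: W_def max_def dot_square_norm power2_less_imp_less split: if_splits)
  define r where "r = norm y + \<rho> 1"
  have W0: "W t x = 0" if "t \<in> {1..\<tau>}" "r < norm x" for t x
  proof (rule ccontr)
    assume "W t x \<noteq> 0"
    then have "0 < W t x" by (simp add: W_def max_def split: if_splits)
    from W_pos[OF that(1) this] \<rho>_le[OF that(1)] have "norm (x - y) < \<rho> 1" by simp
    then show False using that(2) norm_triangle_sub[of x y] by (simp add: r_def)
  qed
  have dW_t: "((\<lambda>t. (W t x)\<^sup>2) has_real_derivative - 4 * W t x * \<rho> t * c t) (at t within X)"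
    if "0 < t" for t x X
  proof -
    have "((\<lambda>t. (\<rho> t)\<^sup>2 - (x - y) \<bullet> (x - y)) has_real_derivative - 2 * \<rho> t * c t) (at t within X)"
      using that by (auto intro!: derivative_eq_intros d\<rho>)
    from DERIV_chain2[OF DERIV_square_max_0 this] show ?thesis by (simp add: W_def mult_ac)
  qed
  have dW_x: "((\<lambda>s. (W t (x + s *\<^sub>R b))\<^sup>2) has_real_derivative - 4 * W t x * ((x - y) \<bullet> b)) (at 0)"
    for t x b
  proof -
    have "((\<lambda>s. (\<rho> t)\<^sup>2 - ((x - y) \<bullet> (x - y) + 2 * s * ((x - y) \<bullet> b) + s\<^sup>2 * (b \<bullet> b)))
        has_real_derivative - 2 * ((x - y) \<bullet> b)) (at 0)"
      by (auto intro!: derivative_eq_intros)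
    moreover have "(x + s *\<^sub>R b - y) \<bullet> (x + s *\<^sub>R b - y)
        = (x - y) \<bullet> (x - y) + 2 * s * ((x - y) \<bullet> b) + s\<^sup>2 * (b \<bullet> b)" for s
    proof -
      have "x + s *\<^sub>R b - y = (x - y) + s *\<^sub>R b" by simp
      then show ?thesis
        by (simp only: inner_add_left inner_add_right inner_scaleR_left inner_scaleR_right)
          (simp add: inner_commute power2_eq_square algebra_simps)
    qed
    ultimately have "((\<lambda>s. (\<rho> t)\<^sup>2 - (x + s *\<^sub>R b - y) \<bullet> (x + s *\<^sub>R b - y))
        has_real_derivative - 2 * ((x - y) \<bullet> b)) (at 0)" by simp
    from DERIV_chain2[OF DERIV_square_max_0 this] show ?thesis by (simp add: W_def mult_ac)
  qed
  define grad where "grad t x = (\<Sum>b\<in>Basis. D b t x *\<^sub>R b)" for t x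
  have grad2: "(norm (grad t x))\<^sup>2 = (\<Sum>b\<in>Basis. (D b t x)\<^sup>2)" for t x
    unfolding power2_norm_eq_inner
    by (subst euclidean_inner) (simp add: grad_def inner_sum_left_Basis power2_eq_square)
  have grad_inner: "d \<bullet> grad t x = (\<Sum>b\<in>Basis. D b t x * (d \<bullet> b))" for d t x
    by (simp add: grad_def inner_sum_right)
  define e where "e t x = (ut t x)\<^sup>2 + (c t)\<^sup>2 * (\<Sum>b\<in>Basis. (D b t x)\<^sup>2) + (u t x)\<^sup>2" for t x
  \<comment> \<open>The time derivatives of the energy density \<open>e\<close> and of the weighted density \<open>w\<close>.\<close>
  define e' where "e' t x = 2 * ut t x * utt t x + (2 * c t * c' t * (\<Sum>b\<in>Basis. (D b t x)\<^sup>2)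
      + (c t)\<^sup>2 * (\<Sum>b\<in>Basis. 2 * D b t x * Dt b t x)) + 2 * u t x * ut t x" for t x
  define w where "w t x = (W t x)\<^sup>2 * e t x" for t x
  define w' where "w' t x = - 4 * W t x * \<rho> t * c t * e t x + (W t x)\<^sup>2 * e' t x" for t x
  \<comment> \<open>The integral of the divergence of \<open>flux\<close> vanishes; subtracting \<open>flux'\<close> removes the second space
    derivatives from \<open>w'\<close>.\<close>
  define flux where "flux b t x = 2 * (c t)\<^sup>2 * ((W t x)\<^sup>2 * (ut t x * D b t x))" for b t x
  define flux' where "flux' b t x = 2 * (c t)\<^sup>2 * (- 4 * W t x * ((x - y) \<bullet> b) * (ut t x * D b t x)
      + (W t x)\<^sup>2 * (Dt b t x * D b t x + ut t x * DD b t x))" for b t x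
  note derivs = DERIV_compact_time[OF u_t \<tau>] DERIV_compact_time[OF ut_t \<tau>] DERIV_compact_time[OF D_t \<tau>]
  have dw: "((\<lambda>t. w t x) has_real_derivative w' t x) (at t within {1..\<tau>})" if t: "t \<in> {1..\<tau>}" for t x
  proof -
    have t0: "0 < t" using t by simp
    have "((\<lambda>t. e t x) has_real_derivative e' t x) (at t within {1..\<tau>})"
      unfolding e_def[abs_def] e'_def
      by (auto intro!: derivative_eq_intros derivs dc[OF t0] t sum.cong simp: mult_ac)
    from DERIV_mult[OF dW_t[OF t0] this] show ?thesis
      by (simp add: w_def[abs_def] w'_def algebra_simps)
  qed
  have tT: "t \<in> time_interval T" if "t \<in> {1..\<tau>}" for t
    using that Icc_subset_time_interval[OF \<tau>] by blast
  have dflux: "((\<lambda>s. flux b t (x + s *\<^sub>R b)) has_real_derivative flux' b t x) (at 0)"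
    if t: "t \<in> {1..\<tau>}" and b: "b \<in> Basis" for b t x
    unfolding flux_def flux'_def
    by (rule DERIV_cong[OF DERIV_cmult[OF DERIV_mult[OF dW_x
      DERIV_mult[OF ut_x[OF b tT[OF t]] D_x[OF b tT[OF t]]]]]]) (simp add: algebra_simps)
  have cc: "continuous_on {1..\<tau>} c"
    by (rule DERIV_continuous_on[OF dc]) auto
  have cc': "continuous_on {1..\<tau>} c'"
    unfolding c'_def[abs_def] by (auto intro!: continuous_intros)
  have c\<rho>: "continuous_on {1..\<tau>} \<rho>"
    by (rule DERIV_continuous_on[OF d\<rho>]) auto
  let ?Q = "{1..\<tau>} \<times> (UNIV :: 'a set)"
  have cfst: "continuous_on ?Q (\<lambda>z. f (fst z))" if "continuous_on {1..\<tau>} f" for f :: "real \<Rightarrow> real"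
    by (rule continuous_on_compose2[OF that]) (auto intro!: continuous_intros)
  note conts = continuous_on_compact_time[OF cont_u \<tau>] continuous_on_compact_time[OF cont_ut \<tau>]
    continuous_on_compact_time[OF cont_utt \<tau>] continuous_on_compact_time[OF cont_D \<tau>]
    continuous_on_compact_time[OF cont_DD \<tau>] continuous_on_compact_time[OF cont_Dt \<tau>]
    cfst[OF cc] cfst[OF cc'] cfst[OF c\<rho>]
  have cW: "continuous_on ?Q (\<lambda>z. W (fst z) (snd z))"
    unfolding W_def by (intro continuous_intros conts)
  have cw: "continuous_on ?Q (\<lambda>z. w (fst z) (snd z))"
    unfolding w_def e_def by (intro continuous_intros conts cW)
  have cw': "continuous_on ?Q (\<lambda>z. w' (fst z) (snd z))"
    unfolding w'_def e_def e'_def by (intro continuous_intros conts cW)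
  have cflux: "continuous_on ?Q (\<lambda>z. flux b (fst z) (snd z))" if "b \<in> Basis" for b
    unfolding flux_def by (intro continuous_intros conts cW that)
  have cflux': "continuous_on ?Q (\<lambda>z. flux' b (fst z) (snd z))" if "b \<in> Basis" for b
    unfolding flux'_def by (intro continuous_intros conts cW that)
  have slice: "continuous_on X (f t)" if "continuous_on ?Q (\<lambda>z. f (fst z) (snd z))" "t \<in> {1..\<tau>}"
    for f :: "real \<Rightarrow> 'a \<Rightarrow> real" and t X
    using continuous_on_compose2[OF that(1), of X "\<lambda>x. (t, x)"] that(2)
    by (force intro!: continuous_intros)
  define B :: "'a set" where "B = centred_box (r + 1)"
  have integrable: "f t integrable_on B" if "continuous_on ?Q (\<lambda>z. f (fst z) (snd z))" "t \<in> {1..\<tau>}"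
    for f :: "real \<Rightarrow> 'a \<Rightarrow> real" and t
    unfolding B_def centred_box_def by (intro integrable_continuous slice[OF that])
  obtain K where K: "0 \<le> K" "\<And>t x. t \<in> {1..\<tau>} \<Longrightarrow> x \<in> B \<Longrightarrow> \<bar>u t x\<bar> powr p \<le> K * \<bar>u t x\<bar>"
    using nonlinearity_bound[OF p \<tau>] unfolding B_def by metis
  define E where "E t = integral B (w t)" for t
  define E' where "E' t = integral B (w' t)" for t
  have dE: "(E has_real_derivative E' t) (at t within {1..\<tau>})" if "t \<in> {1..\<tau>}" for t
    unfolding E_def[abs_def] E'_def B_def centred_box_def
  proof (rule leibniz_rule_field_derivative)
    show "continuous_on ({1..\<tau>} \<times> cbox (- ((r + 1) *\<^sub>R One)) ((r + 1) *\<^sub>R One)) (\<lambda>(t, x). w' t x)"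
      unfolding split_beta by (rule continuous_on_subset[OF cw']) auto
  qed (use that dw integrable[OF cw] in \<open>auto simp: B_def centred_box_def\<close>)
  have pointwise: "w' t x - (\<Sum>b\<in>Basis. flux' b t x) \<le> (K + 1) * w t x"
    if t: "1 < t" "t < \<tau>" and x: "x \<in> B" for t x
  proof -
    have tI: "t \<in> {1..\<tau>}" using t by simp
    have "ereal t < T" using tT[OF tI] by (simp add: time_interval_def)
    from wave[OF t(1) this, of x]
    have utt: "utt t x = (c t)\<^sup>2 * (\<Sum>b\<in>Basis. DD b t x) + (\<bar>u t x\<bar> powr p - \<mu> / t * ut t x)"
      using t by (simp add: c_def sound_speed_def powr_minus field_simps flip: powr_add powr_numeral powr_powr)
    have flux: "(\<Sum>b\<in>Basis. flux' b t x)
      = - 8 * (c t)\<^sup>2 * ut t x * W t x * ((x - y) \<bullet> grad t x)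
        + (W t x)\<^sup>2 * (2 * (c t)\<^sup>2 * (\<Sum>b\<in>Basis. D b t x * Dt b t x) + 2 * (c t)\<^sup>2 * ut t x * (\<Sum>b\<in>Basis. DD b t x))"
      unfolding flux'_def grad_inner
      by (simp add: sum_distrib_left sum.distrib[symmetric] algebra_simps sum_negf[symmetric])
    have "w' t x - (\<Sum>b\<in>Basis. flux' b t x) =
        - 4 * W t x * \<rho> t * c t * ((ut t x)\<^sup>2 + (c t)\<^sup>2 * (norm (grad t x))\<^sup>2 + (u t x)\<^sup>2)
      + (W t x)\<^sup>2 * (2 * ut t x * (\<bar>u t x\<bar> powr p - \<mu> / t * ut t x) + 2 * c t * c' t * (norm (grad t x))\<^sup>2 + 2 * u t x * ut t x)
      + 8 * (c t)\<^sup>2 * ut t x * W t x * ((x - y) \<bullet> grad t x)"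
      unfolding flux w'_def e_def e'_def utt grad2
      by (simp add: algebra_simps sum_distrib_left)
    also have "\<dots> \<le> (K + 1) * ((W t x)\<^sup>2 * ((ut t x)\<^sup>2 + (c t)\<^sup>2 * (norm (grad t x))\<^sup>2 + (u t x)\<^sup>2))"
    proof (rule energy_flux_estimate)
      show "c' t \<le> 0" using \<alpha> by (simp add: c'_def)
      show "\<bar>\<bar>u t x\<bar> powr p\<bar> \<le> K * \<bar>u t x\<bar>" using K(2)[OF tI x] by simp
      show "0 < W t x \<Longrightarrow> norm (x - y) \<le> \<rho> t" using W_pos[OF tI, of x] by simp
    qed (use \<mu> t K \<rho>_pos[OF tI] in \<open>auto simp: c_def sound_speed_def W_def\<close>)
    finally show ?thesis by (simp add: w_def e_def grad2)
  qed
  have E'_le: "E' t \<le> (K + 1) * E t" if t: "1 < t" "t < \<tau>" for t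
  proof -
    have tI: "t \<in> {1..\<tau>}" using t by simp
    have "integral B (flux' b t) = 0" if b: "b \<in> Basis" for b
      unfolding B_def
    proof (rule integral_directional_derivative_eq_0[OF b dflux[OF tI b]])
      show "continuous_on UNIV (flux b t)" "continuous_on UNIV (flux' b t)"
        by (rule slice[OF cflux[OF b] tI] slice[OF cflux'[OF b] tI])+
      show "flux b t x = 0" if "r < norm x" for x using W0[OF tI that] by (simp add: flux_def)
    qed simp
    then have flux: "integral B (\<lambda>x. \<Sum>b\<in>Basis. flux' b t x) = 0"
      by (subst integral_sum) (auto intro: integrable[OF cflux' tI])
    have iflux: "(\<lambda>x. \<Sum>b\<in>Basis. flux' b t x) integrable_on B"
      by (intro integrable_sum) (auto intro: integrable[OF cflux' tI])
    have "E' t = integral B (\<lambda>x. w' t x - (\<Sum>b\<in>Basis. flux' b t x))"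
      unfolding E'_def by (subst integral_diff[OF integrable[OF cw' tI] iflux]) (simp add: flux)
    also have "\<dots> \<le> integral B (\<lambda>x. (K + 1) * w t x)"
      using pointwise[OF t] integrable[OF cw' tI] iflux integrable_cmul[OF integrable[OF cw tI], of "K + 1"]
      by (intro integral_le integrable_diff) auto
    also have "\<dots> = (K + 1) * E t" by (simp add: E_def)
    finally show ?thesis .
  qed
  have w_nonneg: "0 \<le> w t x" for t x
    unfolding w_def e_def by (intro mult_nonneg_nonneg add_nonneg_nonneg sum_nonneg) auto
  have "w 1 x = 0" for x
  proof (cases "W 1 x = 0")
    case False
    then have "norm (x - y) < \<rho> 1" using W_pos[of 1 x] \<tau>1 by (simp add: W_def max_def split: if_splits)
    then have "R < norm x" using \<rho>1 norm_triangle_sub[of y x] by (simp add: norm_minus_commute)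
    then show ?thesis using initial_data_vanish[OF supp] by (simp add: w_def e_def)
  qed (simp add: w_def)
  then have "w 1 = (\<lambda>_. 0)" by (rule ext)
  then have "E 1 = 0" by (simp add: E_def)
  moreover have "0 \<le> E \<tau>"
    unfolding E_def using \<tau>1 by (intro integral_nonneg integrable[OF cw] w_nonneg) auto
  ultimately have "E \<tau> = 0" using gronwall_vanishing[OF \<tau>1 dE E'_le] by blast
  moreover have "0 < r + 1" using \<rho>_pos[of 1] \<tau>1 by (simp add: r_def add_nonneg_pos)
  then have "box (- ((r + 1) *\<^sub>R One)) ((r + 1) *\<^sub>R One) \<noteq> ({} :: 'a set)"
    by (auto simp: box_ne_empty inner_sum_left_Basis)
  ultimately have "\<forall>x\<in>B. w \<tau> x = 0"
    using integral_cbox_eq_0_iff[OF slice[OF cw]] \<tau>1 w_nonneg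
    unfolding E_def B_def centred_box_def by auto
  moreover have "y \<in> B" using \<rho>_pos[of 1] \<tau>1 by (auto simp: B_def r_def intro!: mem_centred_box)
  ultimately have "w \<tau> y = 0" by simp
  moreover have "W \<tau> y = \<delta>\<^sup>2" by (simp add: W_def \<rho>_def)
  ultimately have "e \<tau> y = 0" using \<delta> by (simp add: w_def)
  moreover have "(u \<tau> y)\<^sup>2 \<le> e \<tau> y" unfolding e_def by (auto intro!: add_nonneg_nonneg sum_nonneg mult_nonneg_nonneg)
  ultimately show ?thesis by simp
qed

end

section \<open>The spatial integral of a solution\<close>

text \<open>
Jensen's inequality up to a factor. Integrating Young's inequality \<open>\<bar>f\<bar> * x \<le> \<bar>f\<bar> powr p + x powr (p / (p - 1))\<close>
and choosing \<open>x\<close> such that the last term takes half of the left-hand side gives the constant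
\<open>2 powr (- p)\<close>.
\<close>
lemma integral_power_ge:
  fixes f :: "'a::euclidean_space \<Rightarrow> real"
  assumes p: "1 < p" and cf: "continuous_on (cbox a b) f" and V: "measure lborel (cbox a b) \<le> V" "0 < V"
  shows "2 powr (- p) * V powr (- (p - 1)) * \<bar>integral (cbox a b) f\<bar> powr p
    \<le> integral (cbox a b) (\<lambda>x. \<bar>f x\<bar> powr p)"
proof (cases "integral (cbox a b) f = 0")
  case True
  have "0 \<le> integral (cbox a b) (\<lambda>x. \<bar>f x\<bar> powr p)"
    by (cases "(\<lambda>x. \<bar>f x\<bar> powr p) integrable_on cbox a b") (auto intro: integral_nonneg simp: not_integrable_integral)
  then show ?thesis using True by simp
next
  case False
  let ?B = "cbox a b"
  define F where "F = \<bar>integral ?B f\<bar>"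
  have F: "0 < F" using False by (simp add: F_def)
  \<comment> \<open>This solves \<open>V * x powr (p / (p - 1)) = F / 2 * x\<close>.\<close>
  define x where "x = (F / (2 * V)) powr (p - 1)"
  have x: "0 < x" using F V by (simp add: x_def)
  have if1: "f integrable_on ?B" by (rule integrable_continuous[OF cf])
  have if2: "(\<lambda>y. \<bar>f y\<bar>) integrable_on ?B"
    by (intro integrable_continuous continuous_intros cf)
  have if3: "(\<lambda>y. \<bar>f y\<bar> powr p) integrable_on ?B"
    using p by (intro integrable_continuous continuous_on_powr' continuous_intros cf) auto
  have "F \<le> integral ?B (\<lambda>y. \<bar>f y\<bar>)"
    using integral_norm_bound_integral[OF if1 if2] by (simp add: F_def)
  then have "F * x \<le> integral ?B (\<lambda>y. \<bar>f y\<bar>) * x" using x by (intro mult_right_mono) auto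
  also have "\<dots> = integral ?B (\<lambda>y. \<bar>f y\<bar> * x)" by simp
  also have "\<dots> \<le> integral ?B (\<lambda>y. \<bar>f y\<bar> powr p + x powr (p / (p - 1)))"
  proof (rule integral_le)
    show "(\<lambda>y. \<bar>f y\<bar> * x) integrable_on ?B"
      by (intro integrable_continuous continuous_intros cf)
    show "(\<lambda>y. \<bar>f y\<bar> powr p + x powr (p / (p - 1))) integrable_on ?B"
      by (intro integrable_add if3 integrable_const)
    show "\<bar>f y\<bar> * x \<le> \<bar>f y\<bar> powr p + x powr (p / (p - 1))" for y
      using linear_minus_power_le[OF p _ x, of "\<bar>f y\<bar>" 1] by simp
  qed
  also have "\<dots> = integral ?B (\<lambda>y. \<bar>f y\<bar> powr p) + measure lborel ?B * x powr (p / (p - 1))"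
    by (subst integral_add[OF if3 integrable_const]) simp
  also have "\<dots> \<le> integral ?B (\<lambda>y. \<bar>f y\<bar> powr p) + V * x powr (p / (p - 1))"
    using V by (intro add_left_mono mult_right_mono) auto
  also have "V * x powr (p / (p - 1)) = F / 2 * x"
  proof -
    have "x powr (p / (p - 1)) = (F / (2 * V)) powr ((p - 1) + 1)"
      using p by (simp add: x_def powr_powr)
    also have "\<dots> = x * (F / (2 * V))"
      using F V by (subst powr_add) (simp add: x_def)
    finally show ?thesis using V by simp
  qed
  finally have "F / 2 * x \<le> integral ?B (\<lambda>y. \<bar>f y\<bar> powr p)" by simp
  moreover have "F / 2 * x = 2 powr (- p) * V powr (- (p - 1)) * F powr p"
  proof -
    have "(F / (2 * V)) powr y = F powr y * 2 powr (- y) * V powr (- y)" for y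
      using F V by (simp add: powr_divide powr_mult powr_minus field_simps)
    from this[of "p - 1"]
    have "F / 2 * x = (F powr 1 * F powr (p - 1)) * (2 powr (-1) * 2 powr (- (p - 1))) * V powr (- (p - 1))"
      using F by (simp add: x_def powr_minus[of 2 1, simplified] del: minus_diff_eq)
    also have "\<dots> = 2 powr (- p) * V powr (- (p - 1)) * F powr p"
      unfolding powr_add[symmetric] by simp
    finally show ?thesis .
  qed
  ultimately show ?thesis by (simp add: F_def)
qed

lemma Ck_on_Suc_imp_continuous_on: "Ck_on (Suc k) S f \<Longrightarrow> continuous_on S f"
  unfolding Ck_on.simps continuous_on_eq_continuous_within using has_derivative_continuous by blast

lemma integral_bump_pos:
  fixes f :: "'a::euclidean_space \<Rightarrow> real"
  assumes "continuous_on UNIV f" "\<And>x. 0 \<le> f x" "f z \<noteq> 0" "\<And>x. R < norm x \<Longrightarrow> f x = 0" "0 < R"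
  shows "0 < integral (centred_box R) f"
proof -
  have ne: "box (- (R *\<^sub>R One)) (R *\<^sub>R One) \<noteq> ({} :: 'a set)"
    using \<open>0 < R\<close> by (auto simp: box_ne_empty inner_sum_left_Basis)
  have c: "continuous_on (cbox (- (R *\<^sub>R One)) (R *\<^sub>R One)) f"
    using assms(1) continuous_on_subset by blast
  have "z \<in> centred_box R" using assms(3,4) mem_centred_box not_le by blast
  then have "integral (centred_box R) f \<noteq> 0"
    using integral_cbox_eq_0_iff[OF c ne] assms(2,3) unfolding centred_box_def by auto
  moreover have "0 \<le> integral (centred_box R) f"
    unfolding centred_box_def using assms(2) by (intro integral_nonneg integrable_continuous c)
  ultimately show ?thesis by simp
qed

lemma centred_box_mono: "r \<le> s \<Longrightarrow> centred_box r \<subseteq> centred_box s"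
  by (force simp: centred_box_def mem_box inner_sum_left_Basis)

lemma integral_centred_box_eq:
  fixes f :: "'a::euclidean_space \<Rightarrow> real"
  assumes "continuous_on UNIV f" "\<And>x. r < norm x \<Longrightarrow> f x = 0" "r \<le> s"
  shows "integral (centred_box s) f = integral (centred_box r) f"
proof (rule integral_unique, rule has_integral_on_superset)
  show "(f has_integral integral (centred_box r) f) (centred_box r)"
    unfolding centred_box_def using assms(1)
    by (intro integrable_integral integrable_continuous) (auto intro: continuous_on_subset)
  show "f x = 0" if "x \<notin> centred_box r" for x
    using that mem_centred_box assms(2) not_le by blast
qed (rule centred_box_mono[OF assms(3)])

text \<open>
The first factor is the constant in \<open>integral_power_ge\<close>; the base of the second, times
\<open>t powr (n * (1 - \<alpha>))\<close>, bounds the volume of a cube containing the support at time \<open>t\<close>.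
\<close>
definition mass_ode_const :: "nat \<Rightarrow> real \<Rightarrow> real \<Rightarrow> real \<Rightarrow> real" where
  "mass_ode_const n \<alpha> R p = 2 powr (- p) * ((2 * (R + 1 / (1 - \<alpha>))) ^ n) powr (- (p - 1))"

context damped_wave
begin

text \<open>
On \<open>{1..\<tau>}\<close> all slices \<open>u t\<close> are supported in one fixed cube, so \<open>F\<close> may be differentiated under the
integral, and the integral of the Laplacian vanishes. For the lower bound the integral is restricted to
the cube of half-width \<open>\<rho> t = R + sound_distance \<alpha> t\<close>, whose volume is at most a constant times
\<open>t powr (n * (1 - \<alpha>))\<close> for \<open>n = DIM('a)\<close>.
\<close>
lemma mass_satisfies_fujita_ode:
  assumes \<alpha>: "0 \<le> \<alpha>" "\<alpha> < 1" and \<mu>: "0 \<le> \<mu>" and p: "1 < p" and R: "0 < R"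
    and supp: "\<And>x. R < norm x \<Longrightarrow> u0 x = 0 \<and> u1 x = 0"
    and cu0: "continuous_on UNIV u0" and cu1: "continuous_on UNIV u1"
    and \<tau>: "1 < \<tau>" "ereal \<tau> < T"
  shows "\<exists>F F' F''. fujita_ode \<mu> (mass_ode_const DIM('a) \<alpha> R p) (real DIM('a) * (1 - \<alpha>) * (p - 1)) p
    (\<epsilon> * integral (centred_box R) u0) (\<epsilon> * integral (centred_box R) u1) \<tau> F F' F''"
proof -
  have \<tau>I: "\<tau> \<in> time_interval T" using \<tau> by (simp add: time_interval_def)
  have tT: "t \<in> time_interval T" if "t \<in> {1..\<tau>}" for t
    using that Icc_subset_time_interval[OF \<tau>I] by blast
  define \<rho> where "\<rho> t = R + sound_distance \<alpha> t" for t
  have \<rho>_ge: "R \<le> \<rho> t" if "t \<in> {1..\<tau>}" for t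
    using sound_distance_mono[OF \<alpha>(2), of 1 t] that by (simp add: \<rho>_def)
  have \<rho>_le: "\<rho> t \<le> \<rho> \<tau>" if "t \<in> {1..\<tau>}" for t
    using sound_distance_mono[OF \<alpha>(2), of t \<tau>] that by (simp add: \<rho>_def)
  have u0': "u t x = 0" if "t \<in> {1..\<tau>}" "\<rho> t < norm x" for t x
    using finite_propagation_speed[OF \<alpha> \<mu> p supp tT] that by (simp add: \<rho>_def)
  define B :: "'a set" where "B = centred_box (\<rho> \<tau> + 1)"
  define F where "F t = integral B (u t)" for t
  define F' where "F' t = integral B (ut t)" for t
  define F'' where "F'' t = integral B (utt t)" for t
  have integrable: "f t integrable_on B"
    if "continuous_on (time_interval T \<times> UNIV) (\<lambda>(t, x). f t x)" "t \<in> {1..\<tau>}"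
    for f :: "real \<Rightarrow> 'a \<Rightarrow> real" and t
    unfolding B_def centred_box_def
    using continuous_on_slice[OF that(1) tT[OF that(2)]]
    by (intro integrable_continuous) (auto intro: continuous_on_subset)
  have deriv_integral: "((\<lambda>t. integral B (f t)) has_real_derivative integral B (f' t)) (at t within {1..\<tau>})"
    if f: "\<And>t x. t \<in> time_interval T \<Longrightarrow> ((\<lambda>s. f s x) has_real_derivative f' t x) (at t within time_interval T)"
      and cf: "continuous_on (time_interval T \<times> UNIV) (\<lambda>(t, x). f t x)"
      and cf': "continuous_on (time_interval T \<times> UNIV) (\<lambda>(t, x). f' t x)" and t: "t \<in> {1..\<tau>}"
    for f f' :: "real \<Rightarrow> 'a \<Rightarrow> real" and t
    unfolding B_def centred_box_def
  proof (rule leibniz_rule_field_derivative)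
    show "continuous_on ({1..\<tau>} \<times> cbox (- ((\<rho> \<tau> + 1) *\<^sub>R One)) ((\<rho> \<tau> + 1) *\<^sub>R One)) (\<lambda>(t, x). f' t x)"
      unfolding split_beta by (rule continuous_on_subset[OF continuous_on_compact_time[OF cf' \<tau>I]]) auto
  qed (use t DERIV_compact_time[OF f \<tau>I] integrable[OF cf] in \<open>auto simp: B_def centred_box_def\<close>)
  have "fujita_ode \<mu> (mass_ode_const DIM('a) \<alpha> R p) (real DIM('a) * (1 - \<alpha>) * (p - 1)) p
    (\<epsilon> * integral (centred_box R) u0) (\<epsilon> * integral (centred_box R) u1) \<tau> F F' F''"
    unfolding fujita_ode_def
  proof (intro conjI ballI allI impI)
    fix t assume t: "t \<in> {1..\<tau>}"
    show "(F has_real_derivative F' t) (at t within {1..\<tau>})"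
      unfolding F_def[abs_def] F'_def by (rule deriv_integral[OF u_t cont_u cont_ut t])
    show "(F' has_real_derivative F'' t) (at t within {1..\<tau>})"
      unfolding F'_def[abs_def] F''_def by (rule deriv_integral[OF ut_t cont_ut cont_utt t])
  next
    have R\<rho>: "R \<le> \<rho> \<tau> + 1" using \<rho>_ge[of \<tau>] \<tau> by simp
    have "u 1 = (\<lambda>x. \<epsilon> * u0 x)" "ut 1 = (\<lambda>x. \<epsilon> * u1 x)" by (auto simp: init_u init_ut)
    then show "F 1 = \<epsilon> * integral (centred_box R) u0" "F' 1 = \<epsilon> * integral (centred_box R) u1"
      using integral_centred_box_eq[OF cu0 _ R\<rho>] integral_centred_box_eq[OF cu1 _ R\<rho>] supp
      by (simp_all add: F_def F'_def B_def)
  next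
    fix t assume t': "1 < t \<and> t < \<tau>"
    then have t: "t \<in> {1..\<tau>}" by simp
    have "ereal t < T" using tT[OF t] by (simp add: time_interval_def)
    note wave_t = wave[OF conjunct1[OF t'] this]
    have DD0: "integral B (DD b t) = 0" if b: "b \<in> Basis" for b
      unfolding B_def
    proof (rule integral_directional_derivative_eq_0[OF b D_x[OF b tT[OF t]]])
      show "continuous_on UNIV (D b t)" "continuous_on UNIV (DD b t)"
        by (rule continuous_on_slice[OF cont_D[OF b] tT[OF t]] continuous_on_slice[OF cont_DD[OF b] tT[OF t]])+
      show "\<rho> t + 1 \<le> \<rho> \<tau> + 1" using \<rho>_le[OF t] by simp
      show "D b t x = 0" if x: "\<rho> t < norm x" for x
      proof -
        have "open {s. \<rho> t < norm (x + s *\<^sub>R b)}" by (intro open_Collect_less continuous_intros)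
        moreover have "((\<lambda>_. 0) has_real_derivative 0) (at (0::real))" by simp
        ultimately have "((\<lambda>s. u t (x + s *\<^sub>R b)) has_real_derivative 0) (at 0)"
          using x u0'[OF t] by (elim has_field_derivative_transform_within_open) auto
        then show ?thesis using u_x[OF b tT[OF t]] DERIV_unique by blast
      qed
    qed
    have ilap: "(\<lambda>x. \<Sum>b\<in>Basis. DD b t x) integrable_on B"
      by (intro integrable_sum) (auto intro: integrable[OF cont_DD t])
    have lap0: "integral B (\<lambda>x. \<Sum>b\<in>Basis. DD b t x) = 0"
      by (subst integral_sum) (auto intro: integrable[OF cont_DD t] simp: DD0)
    have "integral B (\<lambda>x. \<bar>u t x\<bar> powr p)
        = integral B (\<lambda>x. (utt t x + \<mu> / t * ut t x) - 1 / (t powr (2 * \<alpha>)) * (\<Sum>b\<in>Basis. DD b t x))"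
      using wave_t by (intro integral_cong) (simp add: algebra_simps)
    also have "\<dots> = F'' t + \<mu> / t * F' t"
      using integrable[OF cont_utt t] integrable_cmul[OF integrable[OF cont_ut t], of "\<mu> / t"]
        integrable_cmul[OF ilap, of "1 / (t powr (2 * \<alpha>))"] lap0
      by (simp add: integral_diff integral_add integrable_add F''_def F'_def del: times_divide_eq_left)
    finally have mass: "F'' t + \<mu> / t * F' t = integral B (\<lambda>x. \<bar>u t x\<bar> powr p)" ..
    have cu: "continuous_on X (u t)" for X
      using continuous_on_slice[OF cont_u tT[OF t]] continuous_on_subset by blast
    have Ft: "F t = integral (centred_box (\<rho> t)) (u t)"
      unfolding F_def B_def using \<rho>_le[OF t] u0'[OF t] by (intro integral_centred_box_eq cu) auto
    have "0 < \<rho> t" using \<rho>_ge[OF t] R by simp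
    define V where "V = (2 * (R + 1 / (1 - \<alpha>))) ^ DIM('a) * t powr (real DIM('a) * (1 - \<alpha>))"
    have K: "0 < R + 1 / (1 - \<alpha>)" using R \<alpha> by (intro add_pos_pos) auto
    then have V: "0 < V" using t by (simp add: V_def)
    have "\<rho> t \<le> (R + 1 / (1 - \<alpha>)) * t powr (1 - \<alpha>)"
    proof -
      have "1 \<le> t powr (1 - \<alpha>)" using t \<alpha> by (intro ge_one_powr_ge_zero) auto
      then have "R * 1 \<le> R * t powr (1 - \<alpha>)" using R by (intro mult_left_mono) auto
      moreover have "sound_distance \<alpha> t \<le> t powr (1 - \<alpha>) / (1 - \<alpha>)"
        unfolding sound_distance_def using \<alpha> by (intro divide_right_mono) auto
      ultimately show ?thesis by (simp add: \<rho>_def algebra_simps)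
    qed
    then have "(2 * \<rho> t) ^ DIM('a) \<le> (2 * ((R + 1 / (1 - \<alpha>)) * t powr (1 - \<alpha>))) ^ DIM('a)"
      using \<open>0 < \<rho> t\<close> by (intro power_mono) auto
    also have "\<dots> = (2 * (R + 1 / (1 - \<alpha>))) ^ DIM('a) * (t powr (1 - \<alpha>)) ^ DIM('a)"
      by (simp only: power_mult_distrib mult.assoc)
    also have "(t powr (1 - \<alpha>)) ^ DIM('a) = t powr (real DIM('a) * (1 - \<alpha>))"
      using t by (simp add: powr_realpow[symmetric] powr_powr mult.commute)
    also have "(2 * (R + 1 / (1 - \<alpha>))) ^ DIM('a) * \<dots> = V" by (simp only: V_def)
    finally have "measure lborel (centred_box (\<rho> t) :: 'a set) \<le> V"
      using \<open>0 < \<rho> t\<close> by (subst content_centred_box) auto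
    then have "2 powr (- p) * V powr (- (p - 1)) * \<bar>F t\<bar> powr p
        \<le> integral (centred_box (\<rho> t)) (\<lambda>x. \<bar>u t x\<bar> powr p)"
      unfolding Ft centred_box_def using V by (intro integral_power_ge p cu) auto
    also have "\<dots> = integral B (\<lambda>x. \<bar>u t x\<bar> powr p)"
      unfolding B_def using \<rho>_le[OF t] u0'[OF t] p
      by (intro integral_centred_box_eq[symmetric] continuous_on_powr' continuous_intros cu) auto
    also have "2 powr (- p) * V powr (- (p - 1))
        = mass_ode_const DIM('a) \<alpha> R p * t powr (- (real DIM('a) * (1 - \<alpha>) * (p - 1)))"
      using t K by (simp add: V_def mass_ode_const_def powr_mult powr_powr algebra_simps)
    finally show "mass_ode_const DIM('a) \<alpha> R p * t powr (- (real DIM('a) * (1 - \<alpha>) * (p - 1))) * \<bar>F t\<bar> powr p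
        \<le> F'' t + \<mu> / t * F' t"
      unfolding mass .
  qed
  then show ?thesis by blast
qed

end

section \<open>Lifespan estimates\<close>

lemma existence_time_le:
  fixes T :: ereal
  assumes "1 < T" and le: "\<And>\<tau>. 1 < \<tau> \<Longrightarrow> ereal \<tau> < T \<Longrightarrow> \<tau> \<le> M"
  shows "T \<le> ereal M"
proof (rule ccontr)
  assume "\<not> T \<le> ereal M"
  then have "ereal (max 1 M) < T" using \<open>1 < T\<close> by (simp add: max_def one_ereal_def not_le)
  then obtain \<tau> where \<tau>: "max 1 M < \<tau>" "ereal \<tau> < T" using ereal_dense2[of "ereal (max 1 M)" T] by auto
  then show False using le[of \<tau>] by simp
qed

text \<open>
What matters is that \<open>c\<close>, \<open>A\<close> and \<open>B\<close> are the same for all \<open>\<epsilon>\<close>, all solutions and all times.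
\<close>
lemma classical_solution_mass_ode:
  fixes u0 u1 :: "'a::euclidean_space \<Rightarrow> real"
  assumes \<alpha>: "0 \<le> \<alpha>" "\<alpha> < 1" and \<mu>: "0 \<le> \<mu>" and p: "1 < p" and R: "0 < R"
    and c0: "continuous_on UNIV u0" and c1: "continuous_on UNIV u1"
    and nonneg: "\<And>x. 0 \<le> u0 x" "\<And>x. 0 \<le> u1 x" and nontriv: "\<exists>x. u0 x \<noteq> 0" "\<exists>x. u1 x \<noteq> 0"
    and supp: "\<And>x. R < norm x \<Longrightarrow> u0 x = 0 \<and> u1 x = 0"
  obtains c A B where "0 < c" "0 < A" "0 < B"
    "\<And>\<epsilon> T u \<tau>. classical_solution \<alpha> \<mu> p \<epsilon> u0 u1 T u \<Longrightarrow> 1 < \<tau> \<Longrightarrow> ereal \<tau> < T \<Longrightarrow>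
      \<exists>F F' F''. fujita_ode \<mu> c (real DIM('a) * (1 - \<alpha>) * (p - 1)) p (\<epsilon> * A) (\<epsilon> * B) \<tau> F F' F''"
proof
  have "0 < 2 * (R + 1 / (1 - \<alpha>))" using R \<alpha> by (intro mult_pos_pos add_pos_pos) auto
  then show "0 < mass_ode_const DIM('a) \<alpha> R p" unfolding mass_ode_const_def by auto
  show "0 < integral (centred_box R) u0" "0 < integral (centred_box R) u1"
    using integral_bump_pos[OF c0 nonneg(1) _ _ R] integral_bump_pos[OF c1 nonneg(2) _ _ R] nontriv supp by blast+
  fix \<epsilon> T u \<tau>
  assume sol: "classical_solution \<alpha> \<mu> p \<epsilon> u0 u1 T u" and \<tau>: "1 < \<tau>" "ereal \<tau> < T"
  obtain ut utt D DD Dt where "damped_wave T \<alpha> \<mu> p \<epsilon> u0 u1 u ut utt D DD Dt"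
    using classical_solution_imp_damped_wave[OF sol] .
  then interpret damped_wave T \<alpha> \<mu> p \<epsilon> u0 u1 u ut utt D DD Dt .
  show "\<exists>F F' F''. fujita_ode \<mu> (mass_ode_const DIM('a) \<alpha> R p) (real DIM('a) * (1 - \<alpha>) * (p - 1)) p
      (\<epsilon> * integral (centred_box R) u0) (\<epsilon> * integral (centred_box R) u1) \<tau> F F' F''"
    by (rule mass_satisfies_fujita_ode[OF \<alpha> \<mu> p R supp c0 c1 \<tau>])
qed

theorem theorem1p1:
  fixes u0 u1 :: "real ^ 'n \<Rightarrow> real"
    and \<alpha> \<mu> p R :: real
  assumes "CARD('n) \<ge> 2"
    and "0 \<le> \<alpha>" and "\<alpha> < 1"
    and "0 \<le> \<mu>"
    and "1 < p" and "p \<le> fujita_exponent (real CARD('n) * (1 - \<alpha>))"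
    and "Ck_on 2 UNIV u0" and "Ck_on 1 UNIV u1"
    and "\<forall>x. 0 \<le> u0 x" and "\<forall>x. 0 \<le> u1 x"
    and "\<exists>x. u0 x \<noteq> 0" and "\<exists>x. u1 x \<noteq> 0"
    and "R > 0"
    and "closure (support_on UNIV u0) \<subseteq> {x. norm x \<le> R}"
    and "closure (support_on UNIV u1) \<subseteq> {x. norm x \<le> R}"
  shows "(\<forall>\<epsilon> T u. 0 < \<epsilon> \<and> classical_solution \<alpha> \<mu> p \<epsilon> u0 u1 T u \<longrightarrow> T < \<infinity>) \<and>
    (\<exists>\<epsilon>0>0. \<exists>C>0. \<forall>\<epsilon>. 0 < \<epsilon> \<and> \<epsilon> \<le> \<epsilon>0 \<longrightarrow>
       (p < fujita_exponent (real CARD('n) * (1 - \<alpha>)) \<longrightarrow>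
          lifespan \<alpha> \<mu> p u0 u1 \<epsilon>
            \<le> ereal (C * \<epsilon> powr (- ((p - 1) / (2 - real CARD('n) * (1 - \<alpha>) * (p - 1)))))) \<and>
       (p = fujita_exponent (real CARD('n) * (1 - \<alpha>)) \<and> \<mu> \<le> 1 \<longrightarrow>
          lifespan \<alpha> \<mu> p u0 u1 \<epsilon>
            \<le> ereal (exp (C * \<epsilon> powr (- (p * (p - 1) / (p + 1)))))) \<and>
       (p = fujita_exponent (real CARD('n) * (1 - \<alpha>)) \<and> \<mu> > 1 \<longrightarrow>
          lifespan \<alpha> \<mu> p u0 u1 \<epsilon>
            \<le> ereal (exp (C * \<epsilon> powr (- (p - 1))))))"
proof -
  note \<alpha> = assms(2,3) and \<mu> = assms(4) and p = assms(5)
  define N where "N = real CARD('n) * (1 - \<alpha>)"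
  define q where "q = N * (p - 1)"
  have N: "0 < N" using assms(1) \<alpha> by (simp add: N_def)
  have sub_iff: "p < fujita_exponent N \<longleftrightarrow> q < 2" and crit_iff: "p = fujita_exponent N \<longleftrightarrow> q = 2"
    using N by (auto simp: fujita_exponent_def q_def field_simps)
  have "q < 2 \<or> q = 2" using assms(6) sub_iff crit_iff unfolding N_def by linarith
  have supp: "u0 x = 0 \<and> u1 x = 0" if "R < norm x" for x
    using that assms(14,15) closure_subset[of "support_on UNIV u0"] closure_subset[of "support_on UNIV u1"]
    by (force simp: support_on_def)
  have cont: "continuous_on UNIV u0" "continuous_on UNIV u1"
    using assms(7,8) unfolding numeral_2_eq_2 One_nat_def by (blast dest: Ck_on_Suc_imp_continuous_on)+
  have q: "q = real DIM(real ^ 'n) * (1 - \<alpha>) * (p - 1)" by (simp add: q_def N_def)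
  obtain c A B where c: "0 < c" and A: "0 < A" and B: "0 < B" and
    ode: "\<And>\<epsilon> T u \<tau>. classical_solution \<alpha> \<mu> p \<epsilon> u0 u1 T u \<Longrightarrow> 1 < \<tau> \<Longrightarrow> ereal \<tau> < T \<Longrightarrow>
      \<exists>F F' F''. fujita_ode \<mu> c q p (\<epsilon> * A) (\<epsilon> * B) \<tau> F F' F''"
    using classical_solution_mass_ode[OF \<alpha> \<mu> p assms(13) cont spec[OF assms(9)] spec[OF assms(10)]
      assms(11,12) supp, folded q] by blast
  have existence: "T \<le> ereal M" if sol: "classical_solution \<alpha> \<mu> p \<epsilon> u0 u1 T u" and
      le: "\<And>\<tau> F F' F''. 1 < \<tau> \<Longrightarrow> fujita_ode \<mu> c q p (\<epsilon> * A) (\<epsilon> * B) \<tau> F F' F'' \<Longrightarrow> \<tau> \<le> M" for \<epsilon> T u M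
  proof (rule existence_time_le)
    show "1 < T" using sol by (simp add: classical_solution_def)
    show "\<tau> \<le> M" if "1 < \<tau>" "ereal \<tau> < T" for \<tau>
      using ode[OF sol that] le[OF that(1)] by blast
  qed
  have lifespan_le: "lifespan \<alpha> \<mu> p u0 u1 \<epsilon> \<le> ereal M" if
      le: "\<And>\<tau> F F' F''. 1 < \<tau> \<Longrightarrow> fujita_ode \<mu> c q p (\<epsilon> * A) (\<epsilon> * B) \<tau> F F' F'' \<Longrightarrow> \<tau> \<le> M" for \<epsilon> M
    unfolding lifespan_def
  proof (rule Sup_least)
    fix T assume "T \<in> {T. \<exists>u. classical_solution \<alpha> \<mu> p \<epsilon> u0 u1 T u}"
    then obtain u where "classical_solution \<alpha> \<mu> p \<epsilon> u0 u1 T u" by blast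
    then show "T \<le> ereal M" using le by (rule existence)
  qed
  have one_le: "1 \<le> \<epsilon> powr (- x)" if "0 < \<epsilon>" "\<epsilon> \<le> 1" "0 \<le> x" for \<epsilon> x :: real
    using powr_mono'[of "- x" 0 \<epsilon>] that by simp
  show ?thesis
  proof (cases "q < 2")
    case True
    obtain C where C: "0 < C" "\<And>\<epsilon> S F F' F''. 0 < \<epsilon> \<Longrightarrow> 1 < S \<Longrightarrow>
        fujita_ode \<mu> c q p (\<epsilon> * A) (\<epsilon> * B) S F F' F'' \<Longrightarrow> S \<le> exp 1 + C * \<epsilon> powr (- ((p - 1) / (2 - q)))"
      using fujita_ode_subcritical[OF c A B p True] by blast
    have "T < \<infinity>" if "0 < \<epsilon>" "classical_solution \<alpha> \<mu> p \<epsilon> u0 u1 T u" for \<epsilon> T u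
      by (rule le_less_trans[OF existence[OF that(2) C(2)[OF that(1)]]]) simp_all
    moreover have "lifespan \<alpha> \<mu> p u0 u1 \<epsilon> \<le> ereal ((exp 1 + C) * \<epsilon> powr (- ((p - 1) / (2 - q))))"
      if \<epsilon>: "0 < \<epsilon>" "\<epsilon> \<le> 1" for \<epsilon>
    proof (rule lifespan_le)
      fix \<tau> F F' F'' assume "1 < \<tau>" "fujita_ode \<mu> c q p (\<epsilon> * A) (\<epsilon> * B) \<tau> F F' F''"
      then have "\<tau> \<le> exp 1 + C * \<epsilon> powr (- ((p - 1) / (2 - q)))" by (rule C(2)[OF \<epsilon>(1)])
      also have "\<dots> \<le> exp 1 * \<epsilon> powr (- ((p - 1) / (2 - q))) + C * \<epsilon> powr (- ((p - 1) / (2 - q)))"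
        using one_le[OF \<epsilon>, of "(p - 1) / (2 - q)"] p True by simp
      finally show "\<tau> \<le> (exp 1 + C) * \<epsilon> powr (- ((p - 1) / (2 - q)))" by (simp only: distrib_right)
    qed
    moreover have "0 < exp 1 + C" using C(1) by (simp add: add_pos_pos)
    ultimately show ?thesis
      using True sub_iff crit_iff unfolding q_def N_def
      by (intro conjI exI[of _ "1::real"] exI[of _ "exp 1 + C"]) auto
  next
    case False
    then have q2: "q = 2" using \<open>q < 2 \<or> q = 2\<close> by simp
    show ?thesis
    proof (cases "\<mu> \<le> 1")
      case True
      obtain C where C: "0 < C" "\<And>\<epsilon> S F F' F''. 0 < \<epsilon> \<Longrightarrow> 1 < S \<Longrightarrow>
          fujita_ode \<mu> c 2 p (\<epsilon> * A) (\<epsilon> * B) S F F' F'' \<Longrightarrow> ln S \<le> C * \<epsilon> powr (- ((p - 1) / (p + 1)))"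
        using fujita_ode_critical_underdamped[OF c A B p True] by blast
      have bound: "\<tau> \<le> exp (C * \<epsilon> powr (- ((p - 1) / (p + 1))))"
        if "0 < \<epsilon>" "1 < \<tau>" "fujita_ode \<mu> c q p (\<epsilon> * A) (\<epsilon> * B) \<tau> F F' F''" for \<epsilon> \<tau> F F' F''
        using C(2)[OF that(1,2) that(3)[unfolded q2]] that(2) by (subst (asm) exp_le_cancel_iff[symmetric]) simp
      have "T < \<infinity>" if "0 < \<epsilon>" "classical_solution \<alpha> \<mu> p \<epsilon> u0 u1 T u" for \<epsilon> T u
        by (rule le_less_trans[OF existence[OF that(2) bound[OF that(1)]]]) simp_all
      moreover have "lifespan \<alpha> \<mu> p u0 u1 \<epsilon> \<le> ereal (exp (C * \<epsilon> powr (- (p * (p - 1) / (p + 1)))))"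
        if \<epsilon>: "0 < \<epsilon>" "\<epsilon> \<le> 1" for \<epsilon>
      proof (rule lifespan_le)
        fix \<tau> F F' F'' assume "1 < \<tau>" "fujita_ode \<mu> c q p (\<epsilon> * A) (\<epsilon> * B) \<tau> F F' F''"
        then have "\<tau> \<le> exp (C * \<epsilon> powr (- ((p - 1) / (p + 1))))" by (rule bound[OF \<epsilon>(1)])
        \<comment> \<open>Since \<open>\<epsilon> \<le> 1\<close> and \<open>p > 1\<close>, raising the exponent only enlarges the bound.\<close>
        also have "(p - 1) / (p + 1) \<le> p * (p - 1) / (p + 1)"
          using p by (intro divide_right_mono) auto
        then have "exp (C * \<epsilon> powr (- ((p - 1) / (p + 1)))) \<le> exp (C * \<epsilon> powr (- (p * (p - 1) / (p + 1))))"
          using C(1) \<epsilon> by (auto intro!: powr_mono' mult_left_mono)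
        finally show "\<tau> \<le> exp (C * \<epsilon> powr (- (p * (p - 1) / (p + 1))))" .
      qed
      ultimately show ?thesis
        using True q2 sub_iff crit_iff C(1) unfolding q_def N_def
        by (intro conjI exI[of _ "1::real"] exI[of _ C]) auto
    next
      case False
      then have \<mu>1: "1 < \<mu>" by simp
      obtain C where C: "0 < C" "\<And>\<epsilon> S F F' F''. 0 < \<epsilon> \<Longrightarrow> 1 < S \<Longrightarrow>
          fujita_ode \<mu> c 2 p (\<epsilon> * A) (\<epsilon> * B) S F F' F'' \<Longrightarrow> ln S \<le> 1 + C * \<epsilon> powr (- (p - 1))"
        using fujita_ode_critical_overdamped[OF c A B p \<mu>1] by blast
      have bound: "\<tau> \<le> exp (1 + C * \<epsilon> powr (- (p - 1)))"
        if "0 < \<epsilon>" "1 < \<tau>" "fujita_ode \<mu> c q p (\<epsilon> * A) (\<epsilon> * B) \<tau> F F' F''" for \<epsilon> \<tau> F F' F''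
        using C(2)[OF that(1,2) that(3)[unfolded q2]] that(2) by (subst (asm) exp_le_cancel_iff[symmetric]) simp
      have "T < \<infinity>" if "0 < \<epsilon>" "classical_solution \<alpha> \<mu> p \<epsilon> u0 u1 T u" for \<epsilon> T u
        by (rule le_less_trans[OF existence[OF that(2) bound[OF that(1)]]]) simp_all
      moreover have "lifespan \<alpha> \<mu> p u0 u1 \<epsilon> \<le> ereal (exp ((1 + C) * \<epsilon> powr (- (p - 1))))"
        if \<epsilon>: "0 < \<epsilon>" "\<epsilon> \<le> 1" for \<epsilon>
      proof (rule lifespan_le)
        fix \<tau> F F' F'' assume "1 < \<tau>" "fujita_ode \<mu> c q p (\<epsilon> * A) (\<epsilon> * B) \<tau> F F' F''"
        then have "\<tau> \<le> exp (1 + C * \<epsilon> powr (- (p - 1)))" by (rule bound[OF \<epsilon>(1)])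
        also have "\<dots> \<le> exp ((1 + C) * \<epsilon> powr (- (p - 1)))"
          using one_le[OF \<epsilon>, of "p - 1"] p by (simp add: distrib_right)
        finally show "\<tau> \<le> exp ((1 + C) * \<epsilon> powr (- (p - 1)))" .
      qed
      ultimately show ?thesis
        using False q2 sub_iff crit_iff C(1) unfolding q_def N_def
        by (intro conjI exI[of _ "1::real"] exI[of _ "1 + C"]) auto
    qed
  qed
qed

end
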